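(* Let $d\ge 2$, $\beta>0$, $h\ge 0$, $J\in\{-1,+1\}$, and let $\mathbb{P}$ be the law on $\Omega=\{-1,+1\}^{\mathbb{Z}^d}$ of a Markov random field $\mathbb{X}=\{X_x\}_{x\in\mathbb{Z}^d}$ with single-site conditional probabilities $$\mathbb{P}\big(X_x=+1\,\big|\,X_{\mathbb{Z}^d\setminus x}=\sigma_{\mathbb{Z}^d\setminus x}\big)=\frac{e^{\beta h}e^{\beta J\sum_{y\sim x}\sigma_y}}{2\cosh\big(\beta h+\beta J\sum_{y\sim x}\sigma_y\big)}.$$ Let $p=e^{-2\beta h}\big(e^{4\beta d}-e^{-4\beta d}\big)$, assume $p<1$, and let $c'=4\beta d$. Suppose $$\sum_{n\ge 1} n(2d-1)^n e^{c'n}\,\mathbb{P}_p(|\mathcal{C}|\ge n)^{1/2}<\infty,$$ where $\mathcal{C}$ is the open cluster of the origin in independent Bernoulli site percolation on $\mathbb{Z}^d$ with parameter $p$ and $\mathbb{P}_p$ is its law. Then $\mathbb{P}$ satisfies the Poincaré inequality: there is $C_P>0$ such that for all $f\in L^2(\mathbb{P})$, $$\int\big(f-\mathbb{E}(f)\big)^2\,d\mathbb{P}\le C_P\,\mathcal{E}(f,f).$$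
   Context: $x\sim y$ means $x,y$ are nearest neighbours in $\mathbb{Z}^d$. For $\eta\in\Omega$ and $x\in\mathbb{Z}^d$, $\eta^x$ denotes the configuration obtained from $\eta$ by flipping the spin at $x$ (i.e. $\eta^x_x=-\eta_x$, $\eta^x_y=\eta_y$ for $y\ne x$), and $\nabla_x f(\eta)=f(\eta^x)-f(\eta)$. The quadratic form is $\mathcal{E}(f,f)=\sum_{x\in\mathbb{Z}^d}\int(\nabla_x f)^2\,d\mathbb{P}$ (possibly infinite). *)

theory Defs
  imports "HOL-Probability.Probability"
begin

definition nbr :: "int ^ 'd \<Rightarrow> int ^ 'd \<Rightarrow> bool" where
  "nbr x y \<longleftrightarrow> (\<Sum>i\<in>UNIV. \<bar>x $ i - y $ i\<bar>) = 1"

definition Omega :: "(int ^ 'd \<Rightarrow> int) measure" where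
  "Omega = PiM UNIV (\<lambda>_. count_space {-1, 1})"

definition flip :: "(int ^ 'd \<Rightarrow> int) \<Rightarrow> int ^ 'd \<Rightarrow> (int ^ 'd \<Rightarrow> int)" where
  "flip \<eta> x = \<eta>(x := - \<eta> x)"

definition outside_sa :: "int ^ 'd \<Rightarrow> (int ^ 'd \<Rightarrow> int) measure" where
  "outside_sa x = vimage_algebra (space Omega) (\<lambda>\<eta>. restrict \<eta> (UNIV - {x}))
      (PiM (UNIV - {x}) (\<lambda>_. count_space {-1, 1}))"

definition spec :: "real \<Rightarrow> real \<Rightarrow> real \<Rightarrow> int ^ 'd \<Rightarrow> (int ^ 'd \<Rightarrow> int) \<Rightarrow> real" where
  "spec \<beta> h J x \<sigma> =
     (let S = real_of_int (\<Sum>y\<in>{y. nbr x y}. \<sigma> y) in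
      exp (\<beta> * h) * exp (\<beta> * J * S) / (2 * cosh (\<beta> * h + \<beta> * J * S)))"

definition is_MRF :: "real \<Rightarrow> real \<Rightarrow> real \<Rightarrow> (int ^ 'd \<Rightarrow> int) measure \<Rightarrow> bool" where
  "is_MRF \<beta> h J P \<longleftrightarrow>
     prob_space P \<and> sets P = sets (Omega :: (int ^ 'd \<Rightarrow> int) measure) \<and>
     (\<forall>(x :: int ^ 'd) A. A \<in> sets (outside_sa x) \<longrightarrow>
        measure P (A \<inter> {\<eta> \<in> space P. \<eta> x = 1}) = (\<integral>\<eta>\<in>A. spec \<beta> h J x \<eta> \<partial>P))"

text \<open>Dirichlet form E(f,f) = sum over x of integral of (nabla_x f)^2, as an extended
  nonnegative real (possibly infinite); the sum over Z^d is the supremum of finite partial sums.\<close>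

definition dirichlet :: "(int ^ 'd \<Rightarrow> int) measure \<Rightarrow> ((int ^ 'd \<Rightarrow> int) \<Rightarrow> real) \<Rightarrow> ennreal" where
  "dirichlet P f = (SUP F\<in>{F. finite F}. \<Sum>x\<in>F. \<integral>\<^sup>+ \<eta>. ennreal ((f (flip \<eta> x) - f \<eta>)\<^sup>2) \<partial>P)"

text \<open>Bernoulli site percolation on Z^d with parameter p (True = open site).\<close>

definition perc :: "real \<Rightarrow> (int ^ 'd \<Rightarrow> bool) measure" where
  "perc p = PiM UNIV (\<lambda>_. measure_pmf (bernoulli_pmf p))"

text \<open>Open cluster of the origin (empty if the origin is closed).\<close>

definition cluster :: "(int ^ 'd \<Rightarrow> bool) \<Rightarrow> (int ^ 'd) set" where
  "cluster \<omega> = {y. \<omega> 0 \<and> (\<lambda>a b. \<omega> a \<and> \<omega> b \<and> nbr a b)\<^sup>*\<^sup>* 0 y}"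

definition cluster_tail :: "real \<Rightarrow> nat \<Rightarrow> ('d::finite) itself \<Rightarrow> real" where
  "cluster_tail p n _ = measure (perc p :: (int ^ 'd \<Rightarrow> bool) measure)
      {\<omega> \<in> space (perc p). \<exists>F. F \<subseteq> cluster \<omega> \<and> finite F \<and> card F = n}"

end

theory Submission
  imports Defs
begin

text \<open>A straight line of open sites shows \<open>P\<^sub>p (|C| \<ge> n) \<ge> p ^ n\<close>, so the summability hypothesis forces
  \<open>(2 d - 1)\<^sup>2 p < 1\<close>, hence \<open>4 d p < 1\<close>. Since the single-site probability varies by at most \<open>p\<close>
  with the neighbours, Dobrushin's uniqueness condition holds, even with an exponential weight.
  For a finite set \<open>L\<close> of sites let \<open>T\<close> be the random-scan heat bath on \<open>L\<close>, a symmetric contraction of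
  \<open>L\<^sup>2(P)\<close>. The oscillations on \<open>L\<close> of a bounded function decay under \<open>T\<close> at a rate
  \<open>\<rho> = 1 - (1 - K) / |L|\<close>; symmetry upgrades this to the energies \<open>\<langle>T\<^sup>i f, (1 - T) T\<^sup>i f\<rangle>\<close>, and
  summing them bounds \<open>\<parallel>f\<parallel>\<^sup>2 - \<parallel>T\<^sup>k f\<parallel>\<^sup>2\<close> by the Dirichlet form, uniformly in \<open>L\<close> and \<open>k\<close>.
  Approximating by cylinder functions makes \<open>\<parallel>T\<^sup>k f\<parallel>\<close> arbitrarily small for centred \<open>f\<close>, and
  truncation removes boundedness.\<close>

text \<open>A uniformly chosen site requires a finite set \<open>L\<close>, but functions of spins
  outside \<open>L\<close> are fixed by the scan, so no single \<open>L\<close> brings every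
  function close to its mean. The decay rate tends to 1 as \<open>L\<close> grows, but the energy of
  the scan carries a factor \<open>1 / card L\<close>; the two cancel and leave
  \<open>2 / (1 - K)\<close>. The oscillation bound alone cannot give this, since its prefactor is a
  sup-norm quantity with no relation to the Dirichlet form. Log-convexity of the energies removes it
  and stands in for the spectral theorem. The constant \<open>K = 4 * d * p\<close> is made of
  \<open>2 * d\<close> neighbours, influence \<open>p\<close> for each, and a factor 2 for the
  growth of the weight along an edge. The measure enters the abstract argument only through
  invariance under resampling one spin.\<close>

section \<open>Two elementary inequalities\<close>

text \<open>If one ratio \<open>t\<close> exceeded \<open>q\<close>, log-convexity would keep all
  later ratios at least \<open>t\<close>, and the sequence would outgrow \<open>C * q ^ i\<close>.
  Each single ratio thus obeys the asymptotic rate, whatever the size of \<open>C\<close>.\<close>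

lemma log_convex_ratio_le:
  fixes a :: "nat \<Rightarrow> real"
  assumes nn: "\<And>i. 0 \<le> a i" and lc: "\<And>i. (a (Suc i))\<^sup>2 \<le> a i * a (Suc (Suc i))"
    and bd: "\<And>i. a i \<le> C * q ^ i" and q0: "0 \<le> q"
  shows "a (Suc j) \<le> q * a j"
proof (rule ccontr)
  assume neg: "\<not> ?thesis"
  have q: "0 < q"
  proof (rule ccontr)
    assume "\<not> 0 < q"
    then have "q = 0" using q0 by simp
    then show False using bd[of "Suc j"] neg by simp
  qed
  from neg have gt: "q * a j < a (Suc j)" by simp
  have aj: "0 < a j"
  proof (rule ccontr)
    assume "\<not> 0 < a j"
    then have "a j = 0" using nn[of j] by simp
    then show False using lc[of j] gt by simp
  qed
  define t where "t = a (Suc j) / a j"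
  have tq: "q < t" using gt aj by (simp add: t_def field_simps)
  have step: "0 < a (j + n) \<and> t * a (j + n) \<le> a (Suc (j + n))" for n
  proof (induction n)
    case 0
    then show ?case using aj by (simp add: t_def)
  next
    case (Suc n)
    let ?x = "a (j + n)" and ?y = "a (Suc (j + n))" and ?z = "a (Suc (Suc (j + n)))"
    have y: "0 < ?y" using Suc tq q by (meson less_le_trans mult_pos_pos order.strict_trans)
    have "?x * (t * ?y) = (t * ?x) * ?y" by simp
    also have "\<dots> \<le> ?y * ?y" using Suc y by (intro mult_right_mono) auto
    also have "\<dots> \<le> ?x * ?z" using lc[of "j + n"] by (simp add: power2_eq_square)
    finally have "t * ?y \<le> ?z" using Suc by (simp only: mult_le_cancel_left_pos)
    then show ?case using y by simp
  qed
  have geo: "t ^ n * a j \<le> a (j + n)" for n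
  proof (induction n)
    case (Suc n)
    have "t ^ Suc n * a j \<le> t * a (j + n)" using Suc tq q by (simp add: mult.assoc mult_left_mono)
    then show ?case using step[of n] by simp
  qed simp
  have "a j * (t / q) ^ n \<le> C * q ^ j" for n
  proof -
    have "t ^ n * a j \<le> C * q ^ j * q ^ n" using geo[of n] bd[of "j + n"] by (simp add: power_add mult.assoc)
    then show ?thesis using q by (simp add: power_divide field_simps)
  qed
  moreover have "\<exists>n. (C * q ^ j) / a j < (t / q) ^ n"
    using tq q by (intro real_arch_pow) simp
  ultimately show False using aj by (metis mult.commute not_le pos_divide_less_eq)
qed

text \<open>This is Cauchy-Schwarz for a positive semidefinite form, reduced to the values of one
  quadratic polynomial along a line.\<close>

lemma discriminant_le:
  fixes A B C :: real
  assumes "\<And>t. 0 \<le> A - 2 * t * B + t\<^sup>2 * C" and "0 \<le> C"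
  shows "B\<^sup>2 \<le> A * C"
proof (cases "C = 0")
  case True
  have "B = 0"
  proof (rule ccontr)
    assume "B \<noteq> 0"
    \<comment> \<open>At this \<open>t\<close> the affine function \<open>A - 2 * t * B\<close>
      takes the value -1.\<close>
    then show False using assms(1)[of "(A + 1) / (2 * B)"] True by (simp add: field_simps)
  qed
  then show ?thesis using True by simp
next
  case False
  then have C: "0 < C" using assms(2) by simp
  \<comment> \<open>\<open>B / C\<close> is the minimiser of the quadratic.\<close>
  have "0 \<le> A - 2 * (B / C) * B + (B / C)\<^sup>2 * C" by (rule assms(1))
  also have "\<dots> = A - B\<^sup>2 / C" using C by (simp add: field_simps power2_eq_square)
  finally show ?thesis using C by (simp add: field_simps)
qed

section \<open>Random-scan heat bath\<close>

text \<open>When \<open>s\<close> is the single-site conditional probability, this is the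
  conditional expectation of \<open>f\<close> given all spins off \<open>x\<close>, written
  pointwise so that no null sets appear.\<close>

definition heat_bath :: "('v \<Rightarrow> ('v \<Rightarrow> int) \<Rightarrow> real) \<Rightarrow> 'v \<Rightarrow> (('v \<Rightarrow> int) \<Rightarrow> real) \<Rightarrow> ('v \<Rightarrow> int) \<Rightarrow> real"
  where "heat_bath s x f \<eta> = s x \<eta> * f (\<eta>(x := 1)) + (1 - s x \<eta>) * f (\<eta>(x := -1))"

text \<open>Here \<open>s x \<eta>\<close> is the conditional probability of a plus spin at \<open>x\<close> given \<open>\<eta>\<close> off \<open>x\<close>, and
  \<open>c x y\<close> bounds the influence of \<open>y\<close> on \<open>x\<close>. The growing weight \<open>w\<close> serves to show that little
  oscillation escapes from a large finite set of sites.\<close>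

locale dobrushin = prob_space P for P :: "('v \<Rightarrow> int) measure" +
  fixes s :: "'v \<Rightarrow> ('v \<Rightarrow> int) \<Rightarrow> real" and c :: "'v \<Rightarrow> 'v \<Rightarrow> real" and w :: "'v \<Rightarrow> real" and K :: real
  assumes sets_P: "sets P = sets (PiM UNIV (\<lambda>_. count_space {-1, 1}))"
    and s_measurable [measurable]: "\<And>x. s x \<in> borel_measurable P"
    and s_range: "\<And>x \<eta>. \<eta> \<in> space P \<Longrightarrow> 0 \<le> s x \<eta> \<and> s x \<eta> \<le> 1"
    and s_influence: "\<And>x y \<eta>. \<eta> \<in> space P \<Longrightarrow> \<bar>s x (\<eta>(y := - \<eta> y)) - s x \<eta>\<bar> \<le> c x y"
    and s_local: "\<And>x \<eta> \<zeta>. \<eta> \<in> space P \<Longrightarrow> \<zeta> \<in> space P \<Longrightarrow> (\<And>y. c x y \<noteq> 0 \<Longrightarrow> \<eta> y = \<zeta> y) \<Longrightarrow> s x \<eta> = s x \<zeta>"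
    and c_diag: "\<And>x. c x x = 0"
    and c_finite: "\<And>x. finite {y. c x y \<noteq> 0}"
    and c_weight: "\<And>x. (\<Sum>y | c x y \<noteq> 0. c x y * w y) \<le> K * w x"
    and w_ge_1: "\<And>x. 1 \<le> w x"
    and w_finite: "\<And>R. finite {y. w y \<le> R}"
    and K_less_1: "K < 1"
    and heat_bath_invariant: "\<And>x f M. f \<in> borel_measurable P \<Longrightarrow> (\<And>\<eta>. \<eta> \<in> space P \<Longrightarrow> \<bar>f \<eta>\<bar> \<le> M)
        \<Longrightarrow> (\<integral>\<eta>. heat_bath s x f \<eta> \<partial>P) = (\<integral>\<eta>. f \<eta> \<partial>P)"
begin

section \<open>Configurations, bounded functions and the single-site projections\<close>

lemma space_P: "space P = {\<eta>. \<forall>y. \<eta> y = -1 \<or> \<eta> y = 1}"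
  using sets_eq_imp_space_eq[OF sets_P] by (auto simp: space_PiM PiE_UNIV_domain)

lemma update_in_space [simp]: "\<eta> \<in> space P \<Longrightarrow> a = 1 \<or> a = -1 \<Longrightarrow> \<eta>(x := a) \<in> space P"
  by (auto simp: space_P)

lemma flip_in_space [simp]: "\<eta> \<in> space P \<Longrightarrow> \<eta>(x := - \<eta> x) \<in> space P"
  by (auto simp: space_P)

lemma c_nonneg: "0 \<le> c x y"
proof -
  obtain \<eta> where "\<eta> \<in> space P" using not_empty by blast
  then show ?thesis using s_influence[of \<eta> x y] by linarith
qed

lemma K_nonneg: "0 \<le> K"
proof -
  have "0 \<le> (\<Sum>y | c x y \<noteq> 0. c x y * w y)" for x
    using c_nonneg w_ge_1 by (intro sum_nonneg mult_nonneg_nonneg) (auto intro: order_trans[OF zero_le_one])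
  then have "0 \<le> K * w undefined" using c_weight order_trans by blast
  then show ?thesis using w_ge_1[of undefined] by (simp add: zero_le_mult_iff)
qed

text \<open>The new spin is the old one or its flip, and the flip has no influence because
  \<open>c x x = 0\<close>. This makes \<open>heat_bath s x\<close> idempotent.\<close>

lemma s_update [simp]: "\<eta> \<in> space P \<Longrightarrow> a = 1 \<or> a = -1 \<Longrightarrow> s x (\<eta>(x := a)) = s x \<eta>"
proof -
  assume \<eta>: "\<eta> \<in> space P" and a: "a = 1 \<or> a = -1"
  have "a = \<eta> x \<or> a = - \<eta> x" using \<eta> a by (auto simp: space_P dest!: spec[of _ x])
  then show ?thesis using s_influence[OF \<eta>, of x x] c_diag[of x] by auto
qed

lemma update_measurable [measurable]: "a = 1 \<or> a = -1 \<Longrightarrow> (\<lambda>\<eta>. \<eta>(x := a)) \<in> measurable P P"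
proof -
  assume a: "a = 1 \<or> a = (-1::int)"
  have "(\<lambda>\<eta>. \<eta>(x := a)) \<in> measurable (PiM UNIV (\<lambda>_. count_space {-1, 1})) (PiM UNIV (\<lambda>_. count_space {-1, 1}))"
    using a by (intro measurable_fun_upd[where J = UNIV]) auto
  then show ?thesis using sets_P measurable_cong_sets by blast
qed

lemma heat_bath_measurable [measurable]:
  assumes [measurable]: "f \<in> borel_measurable P" shows "heat_bath s x f \<in> borel_measurable P"
  unfolding heat_bath_def[abs_def] by measurable

text \<open>Measurability and a sup bound travel together: under a probability measure they make all
  products integrable, and resampling preserves them with the same \<open>M\<close>.\<close>

definition bdd :: "real \<Rightarrow> (('v \<Rightarrow> int) \<Rightarrow> real) \<Rightarrow> bool" where
  "bdd M f \<longleftrightarrow> f \<in> borel_measurable P \<and> (\<forall>\<eta>\<in>space P. \<bar>f \<eta>\<bar> \<le> M)"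

lemma bdd_integrable: "bdd M f \<Longrightarrow> integrable P f"
  by (auto simp: bdd_def intro!: integrable_const_bound[where B = M])

lemma bdd_mult: "bdd M f \<Longrightarrow> bdd N g \<Longrightarrow> bdd (M * N) (\<lambda>\<eta>. f \<eta> * g \<eta>)"
  by (auto simp: bdd_def abs_mult intro!: mult_mono order_trans[OF abs_ge_zero])

lemma bdd_add: "bdd M f \<Longrightarrow> bdd N g \<Longrightarrow> bdd (M + N) (\<lambda>\<eta>. f \<eta> + g \<eta>)"
  by (auto simp: bdd_def intro!: order_trans[OF abs_triangle_ineq] add_mono)

lemma bdd_diff: "bdd M f \<Longrightarrow> bdd N g \<Longrightarrow> bdd (M + N) (\<lambda>\<eta>. f \<eta> - g \<eta>)"
  by (auto simp: bdd_def intro!: order_trans[OF abs_triangle_ineq4] add_mono)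

lemma heat_bath_mono_abs:
  assumes "\<eta> \<in> space P" "\<And>\<xi>. \<xi> \<in> space P \<Longrightarrow> \<bar>f \<xi>\<bar> \<le> M"
  shows "\<bar>heat_bath s x f \<eta>\<bar> \<le> M"
proof -
  have s: "0 \<le> s x \<eta>" "0 \<le> 1 - s x \<eta>" using s_range[OF assms(1), of x] by auto
  have "\<bar>heat_bath s x f \<eta>\<bar> \<le> s x \<eta> * \<bar>f (\<eta>(x := 1))\<bar> + (1 - s x \<eta>) * \<bar>f (\<eta>(x := -1))\<bar>"
    unfolding heat_bath_def using s by (intro order_trans[OF abs_triangle_ineq]) (simp add: abs_mult)
  also have "\<dots> \<le> s x \<eta> * M + (1 - s x \<eta>) * M"
    using s assms by (intro add_mono mult_left_mono) auto
  finally show ?thesis by (simp add: algebra_simps)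
qed

lemma bdd_heat_bath: "bdd M f \<Longrightarrow> bdd M (heat_bath s x f)"
  by (auto simp: bdd_def intro: heat_bath_mono_abs)

lemma heat_bath_integral: "bdd M f \<Longrightarrow> (\<integral>\<eta>. heat_bath s x f \<eta> \<partial>P) = (\<integral>\<eta>. f \<eta> \<partial>P)"
  unfolding bdd_def by (intro heat_bath_invariant) auto

lemma heat_bath_update:
  "\<eta> \<in> space P \<Longrightarrow> a = 1 \<or> a = -1 \<Longrightarrow> heat_bath s x f (\<eta>(x := a)) = heat_bath s x f \<eta>"
  by (simp add: heat_bath_def)

text \<open>An averaged function no longer sees the spin at \<open>x\<close>, so it factors out like
  a known factor in a conditional expectation.\<close>

lemma heat_bath_mult:
  assumes "\<eta> \<in> space P"
  shows "heat_bath s x (\<lambda>\<eta>. heat_bath s x f \<eta> * g \<eta>) \<eta> = heat_bath s x f \<eta> * heat_bath s x g \<eta>"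
proof -
  have "heat_bath s x (\<lambda>\<eta>. heat_bath s x f \<eta> * g \<eta>) \<eta>
      = s x \<eta> * (heat_bath s x f \<eta> * g (\<eta>(x := 1))) + (1 - s x \<eta>) * (heat_bath s x f \<eta> * g (\<eta>(x := -1)))"
    using assms by (subst heat_bath_def) (simp add: heat_bath_update)
  also have "\<dots> = heat_bath s x f \<eta> * (s x \<eta> * g (\<eta>(x := 1)) + (1 - s x \<eta>) * g (\<eta>(x := -1)))"
    by (simp only: distrib_left mult.left_commute)
  finally show ?thesis by (simp only: heat_bath_def[of s x g])
qed

text \<open>Invariance permits one more averaging at \<open>x\<close>, out of which the averaged
  factor is pulled. Since the right-hand side is symmetric in \<open>f\<close> and \<open>g\<close>,
  the operator is an orthogonal projection.\<close>

lemma heat_bath_inner: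
  assumes f: "bdd M f" and g: "bdd N g"
  shows "(\<integral>\<eta>. heat_bath s x f \<eta> * g \<eta> \<partial>P) = (\<integral>\<eta>. heat_bath s x f \<eta> * heat_bath s x g \<eta> \<partial>P)"
proof -
  have "(\<integral>\<eta>. heat_bath s x f \<eta> * g \<eta> \<partial>P) = (\<integral>\<eta>. heat_bath s x (\<lambda>\<eta>. heat_bath s x f \<eta> * g \<eta>) \<eta> \<partial>P)"
    by (rule heat_bath_integral[symmetric, OF bdd_mult[OF bdd_heat_bath[OF f] g]])
  then show ?thesis by (simp add: heat_bath_mult cong: Bochner_Integration.integral_cong)
qed

lemma heat_bath_sym:
  assumes f: "bdd M f" and g: "bdd N g"
  shows "(\<integral>\<eta>. heat_bath s x f \<eta> * g \<eta> \<partial>P) = (\<integral>\<eta>. f \<eta> * heat_bath s x g \<eta> \<partial>P)"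
  using heat_bath_inner[OF f g, of x] heat_bath_inner[OF g f, of x] by (simp add: mult.commute)

text \<open>Pythagoras for an orthogonal projection.\<close>

lemma heat_bath_energy:
  assumes f: "bdd M f"
  shows "(\<integral>\<eta>. f \<eta> * f \<eta> \<partial>P) - (\<integral>\<eta>. f \<eta> * heat_bath s x f \<eta> \<partial>P) = (\<integral>\<eta>. (f \<eta> - heat_bath s x f \<eta>)\<^sup>2 \<partial>P)"
proof -
  let ?g = "heat_bath s x f"
  note g = bdd_heat_bath[OF f, of x]
  note i = bdd_integrable[OF bdd_mult[OF f f]] bdd_integrable[OF bdd_mult[OF f g]] bdd_integrable[OF bdd_mult[OF g g]]
  have "(\<integral>\<eta>. (f \<eta> - ?g \<eta>)\<^sup>2 \<partial>P) = (\<integral>\<eta>. f \<eta> * f \<eta> - f \<eta> * ?g \<eta> - f \<eta> * ?g \<eta> + ?g \<eta> * ?g \<eta> \<partial>P)"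
    by (simp add: power2_eq_square algebra_simps)
  also have "\<dots> = (\<integral>\<eta>. f \<eta> * f \<eta> \<partial>P) - (\<integral>\<eta>. f \<eta> * ?g \<eta> \<partial>P) - (\<integral>\<eta>. f \<eta> * ?g \<eta> \<partial>P) + (\<integral>\<eta>. ?g \<eta> * ?g \<eta> \<partial>P)"
    using i by simp
  finally show ?thesis using heat_bath_inner[OF f f, of x] by (simp add: mult.commute)
qed

text \<open>The left-hand difference is, up to sign, the flip difference times the conditional
  probability of the opposite spin. This is how local energies are dominated by the gradients in the
  Dirichlet form.\<close>

lemma heat_bath_diff: "\<eta> \<in> space P \<Longrightarrow> \<bar>f \<eta> - heat_bath s x f \<eta>\<bar> \<le> \<bar>f (\<eta>(x := - \<eta> x)) - f \<eta>\<bar>"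
proof -
  assume \<eta>: "\<eta> \<in> space P"
  let ?d = "f (\<eta>(x := - \<eta> x)) - f \<eta>"
  have s: "0 \<le> s x \<eta>" "0 \<le> 1 - s x \<eta>" using s_range[OF \<eta>, of x] by auto
  have "\<eta> x = 1 \<or> \<eta> x = -1" using \<eta> by (auto simp: space_P)
  then show ?thesis
  proof
    assume e: "\<eta> x = 1"
    then have "\<eta>(x := 1) = \<eta>" by auto
    then have "f \<eta> - heat_bath s x f \<eta> = - (1 - s x \<eta>) * ?d"
      using e by (simp add: heat_bath_def algebra_simps)
    then show ?thesis using s by (simp add: abs_mult mult_left_le_one_le del: abs_minus_commute)
  next
    assume e: "\<eta> x = -1"
    then have "\<eta>(x := -1) = \<eta>" by auto
    then have "f \<eta> - heat_bath s x f \<eta> = - s x \<eta> * ?d"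
      using e by (simp add: heat_bath_def algebra_simps)
    then show ?thesis using s by (simp add: abs_mult mult_left_le_one_le)
  qed
qed

section \<open>The average of the projections over a finite set of sites\<close>

definition scan :: "'v set \<Rightarrow> (('v \<Rightarrow> int) \<Rightarrow> real) \<Rightarrow> ('v \<Rightarrow> int) \<Rightarrow> real" where
  "scan L f \<eta> = (\<Sum>x\<in>L. heat_bath s x f \<eta>) / card L"

context
  fixes L :: "'v set"
  assumes L: "finite L" "L \<noteq> {}"
begin

lemma card_pos: "0 < real (card L)" "1 \<le> real (card L)"
  using L by (auto simp: card_gt_0_iff Suc_le_eq)

lemma bdd_scan: assumes "bdd M f" shows "bdd M (scan L f)"
proof -
  have "\<bar>scan L f \<eta>\<bar> \<le> M" if "\<eta> \<in> space P" for \<eta>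
  proof -
    have "\<bar>\<Sum>x\<in>L. heat_bath s x f \<eta>\<bar> \<le> (\<Sum>x\<in>L. M)"
      using bdd_heat_bath[OF assms] that by (intro order_trans[OF sum_abs] sum_mono) (auto simp: bdd_def)
    then show ?thesis using card_pos by (simp add: scan_def field_simps)
  qed
  moreover have "scan L f \<in> borel_measurable P"
    unfolding scan_def[abs_def] using bdd_heat_bath[OF assms] by (intro borel_measurable_divide borel_measurable_sum) (auto simp: bdd_def)
  ultimately show ?thesis by (simp add: bdd_def)
qed

lemma bdd_scan_pow: "bdd M f \<Longrightarrow> bdd M ((scan L ^^ k) f)"
  by (induction k) (auto intro: bdd_scan)

lemma scan_integral: assumes "bdd M f" shows "(\<integral>\<eta>. scan L f \<eta> \<partial>P) = (\<integral>\<eta>. f \<eta> \<partial>P)"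
  using card_pos bdd_integrable[OF bdd_heat_bath[OF assms]]
  by (simp add: scan_def heat_bath_integral[OF assms])

lemma scan_pow_integral: "bdd M f \<Longrightarrow> (\<integral>\<eta>. (scan L ^^ k) f \<eta> \<partial>P) = (\<integral>\<eta>. f \<eta> \<partial>P)"
  by (induction k) (auto simp: scan_integral[OF bdd_scan_pow])

lemma inner_scan:
  assumes f: "bdd M f" and g: "bdd N g"
  shows "(\<integral>\<eta>. g \<eta> * scan L f \<eta> \<partial>P) = (\<Sum>x\<in>L. \<integral>\<eta>. g \<eta> * heat_bath s x f \<eta> \<partial>P) / card L"
proof -
  have "(\<integral>\<eta>. g \<eta> * scan L f \<eta> \<partial>P) = (\<integral>\<eta>. (\<Sum>x\<in>L. g \<eta> * heat_bath s x f \<eta>) / card L \<partial>P)"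
    by (simp add: scan_def sum_distrib_left)
  then show ?thesis
    using bdd_integrable[OF bdd_mult[OF g bdd_heat_bath[OF f]]] by simp
qed

lemma scan_sym:
  assumes f: "bdd M f" and g: "bdd N g"
  shows "(\<integral>\<eta>. scan L f \<eta> * g \<eta> \<partial>P) = (\<integral>\<eta>. f \<eta> * scan L g \<eta> \<partial>P)"
proof -
  have "(\<integral>\<eta>. scan L f \<eta> * g \<eta> \<partial>P) = (\<integral>\<eta>. g \<eta> * scan L f \<eta> \<partial>P)"
    by (simp only: mult.commute)
  also have "\<dots> = (\<Sum>x\<in>L. \<integral>\<eta>. heat_bath s x f \<eta> * g \<eta> \<partial>P) / card L"
    unfolding inner_scan[OF f g] by (simp only: mult.commute)
  also have "\<dots> = (\<integral>\<eta>. f \<eta> * scan L g \<eta> \<partial>P)"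
    unfolding inner_scan[OF g f] by (simp only: heat_bath_sym[OF f g])
  finally show ?thesis .
qed

lemma scan_energy:
  assumes f: "bdd M f"
  shows "(\<integral>\<eta>. f \<eta> * f \<eta> \<partial>P) - (\<integral>\<eta>. f \<eta> * scan L f \<eta> \<partial>P)
     = (\<Sum>x\<in>L. \<integral>\<eta>. (f \<eta> - heat_bath s x f \<eta>)\<^sup>2 \<partial>P) / card L"
  using card_pos by (simp add: inner_scan[OF f f] heat_bath_energy[OF f, symmetric] sum_subtractf field_simps)

text \<open>Symmetry moves the scan from one factor to the other, one power at a time, so inner
  products of iterates depend on the sum of the exponents only.\<close>

lemma scan_pow_inner:
  assumes f: "bdd M f"
  shows "(\<integral>\<eta>. (scan L ^^ i) f \<eta> * (scan L ^^ j) f \<eta> \<partial>P) = (\<integral>\<eta>. f \<eta> * (scan L ^^ (i + j)) f \<eta> \<partial>P)"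
proof (induction i arbitrary: j)
  case (Suc i)
  have "(\<integral>\<eta>. (scan L ^^ Suc i) f \<eta> * (scan L ^^ j) f \<eta> \<partial>P) = (\<integral>\<eta>. (scan L ^^ i) f \<eta> * (scan L ^^ Suc j) f \<eta> \<partial>P)"
    using scan_sym[OF bdd_scan_pow[OF f] bdd_scan_pow[OF f]] by simp
  then show ?case using Suc[of "Suc j"] by simp
qed simp

end

section \<open>Decay of oscillations\<close>

text \<open>The bound is required at every configuration, not almost everywhere, because it is later
  added up along explicit chains of single flips.\<close>

definition osc :: "('v \<Rightarrow> real) \<Rightarrow> (('v \<Rightarrow> int) \<Rightarrow> real) \<Rightarrow> bool" where
  "osc v f \<longleftrightarrow> (\<forall>y. \<forall>\<eta>\<in>space P. \<bar>f (\<eta>(y := - \<eta> y)) - f \<eta>\<bar> \<le> v y)"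

lemma osc_nonneg: "osc v f \<Longrightarrow> 0 \<le> v y"
  using not_empty unfolding osc_def by (meson abs_ge_zero ex_in_conv order_trans)

text \<open>Flipping \<open>y\<close> acts in two ways: on \<open>f\<close> itself, which costs
  \<open>v y\<close>, and on the law of the new spin at \<open>x\<close>, which costs its change
  \<open>c x y\<close> times the oscillation \<open>v x\<close>. If \<open>x = y\<close>, resampling
  erases the flipped spin.\<close>

lemma osc_heat_bath:
  assumes f: "osc v f" and \<eta>: "\<eta> \<in> space P"
  shows "\<bar>heat_bath s x f (\<eta>(y := - \<eta> y)) - heat_bath s x f \<eta>\<bar> \<le> (if x = y then 0 else v y + c x y * v x)"
proof (cases "x = y")
  case True
  have "- \<eta> y = 1 \<or> - \<eta> y = -1" using \<eta> by (auto simp: space_P dest: spec[of _ y])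
  then show ?thesis using True heat_bath_update[OF \<eta>] by simp
next
  case False
  let ?\<zeta> = "\<eta>(y := - \<eta> y)" and ?p = "\<eta>(x := 1)" and ?m = "\<eta>(x := -1)"
  let ?a = "s x \<eta>" and ?b = "s x ?\<zeta>"
  have pm: "?p \<in> space P" "?m \<in> space P" using \<eta> by auto
  have \<zeta>: "?\<zeta> \<in> space P" using \<eta> by simp
  have tw: "?\<zeta>(x := 1) = ?p(y := - ?p y)" "?\<zeta>(x := -1) = ?m(y := - ?m y)" "?p = ?m(x := - ?m x)"
    using False by auto
  have b: "0 \<le> ?b" "0 \<le> 1 - ?b" using s_range[OF \<zeta>, of x] by auto
  have D: "\<bar>f (\<xi>(z := - \<xi> z)) - f \<xi>\<bar> \<le> v z" if "\<xi> \<in> space P" for z \<xi>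
    using f that unfolding osc_def by blast
  have d: "\<bar>f (?\<zeta>(x := 1)) - f ?p\<bar> \<le> v y" "\<bar>f (?\<zeta>(x := -1)) - f ?m\<bar> \<le> v y" "\<bar>f ?p - f ?m\<bar> \<le> v x"
    using D[OF pm(1), of y] D[OF pm(2), of y] D[OF pm(2), of x]
    unfolding tw(1)[symmetric] tw(2)[symmetric] tw(3)[symmetric] by blast+
  \<comment> \<open>The first two terms change \<open>f\<close> under the law at the flipped
    configuration; the last changes the law while the two values of \<open>f\<close> are
    kept.\<close>
  have eq: "heat_bath s x f ?\<zeta> - heat_bath s x f \<eta>
      = ?b * (f (?\<zeta>(x := 1)) - f ?p) + (1 - ?b) * (f (?\<zeta>(x := -1)) - f ?m) + (?b - ?a) * (f ?p - f ?m)"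
    by (simp add: heat_bath_def algebra_simps)
  have "\<bar>heat_bath s x f ?\<zeta> - heat_bath s x f \<eta>\<bar> \<le> \<bar>?b * (f (?\<zeta>(x := 1)) - f ?p)\<bar> + \<bar>(1 - ?b) * (f (?\<zeta>(x := -1)) - f ?m)\<bar> + \<bar>(?b - ?a) * (f ?p - f ?m)\<bar>"
    unfolding eq by (rule order_trans[OF abs_triangle_ineq add_right_mono[OF abs_triangle_ineq]])
  also have "\<dots> = ?b * \<bar>f (?\<zeta>(x := 1)) - f ?p\<bar> + (1 - ?b) * \<bar>f (?\<zeta>(x := -1)) - f ?m\<bar> + \<bar>?b - ?a\<bar> * \<bar>f ?p - f ?m\<bar>"
    by (simp only: abs_mult abs_of_nonneg[OF b(1)] abs_of_nonneg[OF b(2)])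
  also have "\<dots> \<le> ?b * v y + (1 - ?b) * v y + c x y * v x"
    by (rule add_mono[OF add_mono[OF mult_left_mono[OF d(1) b(1)] mult_left_mono[OF d(2) b(2)]]
          mult_mono[OF s_influence[OF \<eta>] d(3) c_nonneg abs_ge_zero]])
  finally show ?thesis using False by (simp add: algebra_simps)
qed

text \<open>One step of Dobrushin's comparison matrix, averaged over the updated site. A site
  outside \<open>L\<close> keeps its oscillation and collects what leaks from
  \<open>L\<close>.\<close>

definition scan_osc :: "'v set \<Rightarrow> ('v \<Rightarrow> real) \<Rightarrow> 'v \<Rightarrow> real" where
  "scan_osc L v y = (\<Sum>x\<in>L. if x = y then 0 else v y + c x y * v x) / card L"

lemma osc_scan: assumes "osc v f" shows "osc (scan_osc L v) (scan L f)"
  unfolding osc_def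
proof safe
  fix y \<eta> assume \<eta>: "\<eta> \<in> space P"
  have "\<bar>\<Sum>x\<in>L. heat_bath s x f (\<eta>(y := - \<eta> y)) - heat_bath s x f \<eta>\<bar>
      \<le> (\<Sum>x\<in>L. if x = y then 0 else v y + c x y * v x)"
    by (intro order_trans[OF sum_abs] sum_mono osc_heat_bath assms \<eta>)
  then show "\<bar>scan L f (\<eta>(y := - \<eta> y)) - scan L f \<eta>\<bar> \<le> scan_osc L v y"
    by (simp add: scan_def scan_osc_def sum_subtractf divide_right_mono flip: diff_divide_distrib)
qed

lemma osc_scan_pow: "osc v f \<Longrightarrow> osc ((scan_osc L ^^ k) v) ((scan L ^^ k) f)"
  by (induction k) (auto intro: osc_scan)

lemma scan_osc_nonneg: "(\<And>y. 0 \<le> v y) \<Longrightarrow> 0 \<le> scan_osc L v y"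
  unfolding scan_osc_def by (intro divide_nonneg_nonneg sum_nonneg) (auto simp: c_nonneg)

lemma scan_osc_pow_nonneg: "(\<And>y. 0 \<le> v y) \<Longrightarrow> 0 \<le> (scan_osc L ^^ k) v y"
  by (induction k arbitrary: y) (auto intro: scan_osc_nonneg)

lemma w_pos: "0 < w x" "0 \<le> w x"
  using w_ge_1[of x] by linarith+

lemma osc_bdd: "bdd M f \<Longrightarrow> osc (\<lambda>_. 2 * M) f"
  unfolding osc_def bdd_def
proof safe
  fix y \<eta> assume a: "\<forall>\<eta>\<in>space P. \<bar>f \<eta>\<bar> \<le> M" "\<eta> \<in> space P"
  then have "\<bar>f (\<eta>(y := - \<eta> y))\<bar> \<le> M" "\<bar>f \<eta>\<bar> \<le> M" by auto
  then show "\<bar>f (\<eta>(y := - \<eta> y)) - f \<eta>\<bar> \<le> 2 * M" by linarith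
qed

context
  fixes L :: "'v set"
  assumes L: "finite L" "L \<noteq> {}"
begin

text \<open>Updating \<open>x\<close> removes the weighted oscillation \<open>w x * v x\<close> and
  spreads at most \<open>K\<close> times that amount over the sites influencing \<open>x\<close>.
  The set \<open>T\<close> may exceed \<open>L\<close>, so that leaked oscillation can be counted
  too.\<close>

lemma scan_osc_weight:
  assumes T: "finite T" "L \<subseteq> T" and v: "\<And>y. 0 \<le> v y"
  shows "(\<Sum>y\<in>T. w y * scan_osc L v y) \<le> (\<Sum>y\<in>T. w y * v y) - (1 - K) / card L * (\<Sum>y\<in>L. w y * v y)"
proof -
  let ?N = "real (card L)" and ?S = "\<Sum>y\<in>T. w y * v y"
  have row: "(\<Sum>y\<in>T. w y * (if x = y then 0 else v y + c x y * v x)) \<le> ?S - (1 - K) * (w x * v x)"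
    if "x \<in> L" for x
  proof -
    have x: "x \<in> T" using that T by auto
    have "(\<Sum>y\<in>T. w y * (if x = y then 0 else v y + c x y * v x))
        = (\<Sum>y\<in>T. w y * v y - (if x = y then w x * v x else 0) + v x * (c x y * w y))"
      by (intro sum.cong) (auto simp: c_diag algebra_simps)
    also have "\<dots> = ?S - w x * v x + v x * (\<Sum>y\<in>T. c x y * w y)"
      using T(1) x by (simp add: sum.distrib sum_subtractf sum_distrib_left)
    finally have split: "(\<Sum>y\<in>T. w y * (if x = y then 0 else v y + c x y * v x)) = \<dots>" .
    have "(\<Sum>y\<in>T. c x y * w y) = (\<Sum>y | y \<in> T \<and> c x y \<noteq> 0. c x y * w y)"
      using T(1) by (intro sum.mono_neutral_right) auto
    also have "\<dots> \<le> (\<Sum>y | c x y \<noteq> 0. c x y * w y)"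
      using c_finite[of x] w_pos c_nonneg by (intro sum_mono2) auto
    also have "\<dots> \<le> K * w x" by (rule c_weight)
    finally have "v x * (\<Sum>y\<in>T. c x y * w y) \<le> v x * (K * w x)" using v by (intro mult_left_mono)
    then show ?thesis unfolding split by (simp add: algebra_simps)
  qed
  have "?N * (\<Sum>y\<in>T. w y * scan_osc L v y) = (\<Sum>y\<in>T. \<Sum>x\<in>L. w y * (if x = y then 0 else v y + c x y * v x))"
  proof -
    have "?N * (w y * scan_osc L v y) = (\<Sum>x\<in>L. w y * (if x = y then 0 else v y + c x y * v x))" for y
      unfolding sum_distrib_left[symmetric] scan_osc_def using card_pos[OF L] by simp
    then show ?thesis by (simp only: sum_distrib_left)
  qed
  also have "\<dots> = (\<Sum>x\<in>L. \<Sum>y\<in>T. w y * (if x = y then 0 else v y + c x y * v x))"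
    by (rule sum.swap)
  also have "\<dots> \<le> (\<Sum>x\<in>L. ?S - (1 - K) * (w x * v x))"
    by (intro sum_mono row)
  also have "\<dots> = ?N * (?S - (1 - K) / ?N * (\<Sum>y\<in>L. w y * v y))"
    using card_pos[OF L] by (simp add: sum_subtractf sum_distrib_left right_diff_distrib)
  finally show ?thesis using card_pos[OF L] by (simp only: mult_le_cancel_left_pos)
qed

definition rate :: real where "rate = 1 - (1 - K) / card L"

lemma rate_bounds: "0 \<le> rate" "rate < 1"
proof -
  have "(1 - K) / real (card L) \<le> 1" using K_nonneg card_pos[OF L] by (simp add: divide_le_eq)
  then show "0 \<le> rate" by (simp add: rate_def)
  show "rate < 1" using K_less_1 card_pos[OF L] by (simp add: rate_def)
qed

lemma scan_osc_decay:
  assumes v: "\<And>y. 0 \<le> v y"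
  shows "(\<Sum>y\<in>L. w y * (scan_osc L ^^ k) v y) \<le> rate ^ k * (\<Sum>y\<in>L. w y * v y)"
proof (induction k)
  case (Suc k)
  have "(\<Sum>y\<in>L. w y * (scan_osc L ^^ Suc k) v y) \<le> rate * (\<Sum>y\<in>L. w y * (scan_osc L ^^ k) v y)"
    using scan_osc_weight[OF L(1) order_refl, of "(scan_osc L ^^ k) v"] scan_osc_pow_nonneg[of v, OF v] by (simp add: rate_def algebra_simps)
  also have "\<dots> \<le> rate * (rate ^ k * (\<Sum>y\<in>L. w y * v y))"
    by (intro mult_left_mono Suc rate_bounds)
  finally show ?case by (simp add: mult.assoc)
qed simp

text \<open>Outside \<open>L\<close> oscillation can accumulate, but the total weighted amount never
  grows. Together with a large weight outside \<open>L\<close> this will make the leak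
  small.\<close>

lemma scan_osc_total:
  assumes T: "finite T" "L \<subseteq> T" and v: "\<And>y. 0 \<le> v y"
  shows "(\<Sum>y\<in>T. w y * (scan_osc L ^^ k) v y) \<le> (\<Sum>y\<in>T. w y * v y)"
proof (induction k)
  case (Suc k)
  have "0 \<le> (1 - K) / card L * (\<Sum>y\<in>L. w y * (scan_osc L ^^ k) v y)"
    using K_less_1 w_pos by (intro mult_nonneg_nonneg sum_nonneg) (auto intro!: scan_osc_pow_nonneg v)
  then show ?case
    using Suc scan_osc_weight[OF T, of "(scan_osc L ^^ k) v"] scan_osc_pow_nonneg[of v, OF v] by simp
qed simp

lemma heat_bath_energy_bound:
  assumes f: "bdd M f" and v: "osc v f"
  shows "(\<integral>\<eta>. (f \<eta> - heat_bath s x f \<eta>)\<^sup>2 \<partial>P) \<le> (v x)\<^sup>2"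
proof -
  have "(\<integral>\<eta>. (f \<eta> - heat_bath s x f \<eta>)\<^sup>2 \<partial>P) \<le> (\<integral>\<eta>. (v x)\<^sup>2 \<partial>P)"
  proof (rule integral_mono)
    note b = bdd_diff[OF f bdd_heat_bath[OF f, of x]]
    show "integrable P (\<lambda>\<eta>. (f \<eta> - heat_bath s x f \<eta>)\<^sup>2)"
      using bdd_integrable[OF bdd_mult[OF b b]] by (simp add: power2_eq_square)
    show "(f \<eta> - heat_bath s x f \<eta>)\<^sup>2 \<le> (v x)\<^sup>2" if "\<eta> \<in> space P" for \<eta>
      using heat_bath_diff[OF that, of f x] v that unfolding osc_def
      by (intro abs_le_square_iff[THEN iffD1]) (metis abs_ge_self order_trans)
  qed simp
  then show ?thesis by (simp add: prob_space)
qed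

text \<open>Energies are quadratic in the oscillations, hence the squared rate. The prefactor is
  still a sup-norm quantity.\<close>

lemma energy_decay:
  assumes f: "bdd M f" and v: "osc v f"
  shows "(\<Sum>x\<in>L. \<integral>\<eta>. ((scan L ^^ i) f \<eta> - heat_bath s x ((scan L ^^ i) f) \<eta>)\<^sup>2 \<partial>P) / card L
     \<le> (\<Sum>y\<in>L. w y * v y)\<^sup>2 * (rate\<^sup>2) ^ i"
proof -
  let ?v = "(scan_osc L ^^ i) v"
  have v0: "0 \<le> ?v y" for y by (intro scan_osc_pow_nonneg osc_nonneg[OF v])
  have "(\<integral>\<eta>. ((scan L ^^ i) f \<eta> - heat_bath s x ((scan L ^^ i) f) \<eta>)\<^sup>2 \<partial>P) \<le> (\<Sum>y\<in>L. w y * ?v y)\<^sup>2"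
    if "x \<in> L" for x
  proof -
    \<comment> \<open>Since \<open>w\<close> is at least 1, a single oscillation is dominated by the
      weighted sum, for which the decay is known.\<close>
    have "?v x \<le> w x * ?v x" using w_ge_1[of x] v0[of x] by (simp add: mult_le_cancel_right1)
    also have "\<dots> \<le> (\<Sum>y\<in>L. w y * ?v y)"
      using that L v0 w_pos by (intro member_le_sum) auto
    finally have "(?v x)\<^sup>2 \<le> (\<Sum>y\<in>L. w y * ?v y)\<^sup>2" using v0 by (intro power_mono)
    then show ?thesis
      by (rule order_trans[OF heat_bath_energy_bound[OF bdd_scan_pow[OF L f] osc_scan_pow[OF v]]])
  qed
  then have "(\<Sum>x\<in>L. \<integral>\<eta>. ((scan L ^^ i) f \<eta> - heat_bath s x ((scan L ^^ i) f) \<eta>)\<^sup>2 \<partial>P)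
      \<le> card L * (\<Sum>y\<in>L. w y * ?v y)\<^sup>2"
    by (rule sum_bounded_above)
  also have "\<dots> \<le> card L * (rate ^ i * (\<Sum>y\<in>L. w y * v y))\<^sup>2"
    using scan_osc_decay[of v i] osc_nonneg[OF v] v0 w_pos
    by (intro mult_left_mono power_mono sum_nonneg mult_nonneg_nonneg) auto
  finally show ?thesis
    using card_pos[OF L] by (simp add: divide_le_eq power_mult_distrib power_mult[symmetric] mult.commute)
qed

end

section \<open>Energy decay and ergodicity\<close>

lemma bdd_scale: "bdd M f \<Longrightarrow> bdd (\<bar>t\<bar> * M) (\<lambda>\<eta>. t * f \<eta>)"
  by (auto simp: bdd_def abs_mult intro!: mult_left_mono)

lemma scan_linear: "scan L (\<lambda>\<eta>. f \<eta> - t * g \<eta>) = (\<lambda>\<eta>. scan L f \<eta> - t * scan L g \<eta>)"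
proof
  fix \<eta>
  have "heat_bath s x (\<lambda>\<eta>. f \<eta> - t * g \<eta>) \<eta> = heat_bath s x f \<eta> - t * heat_bath s x g \<eta>" for x
    by (simp add: heat_bath_def algebra_simps)
  then show "scan L (\<lambda>\<eta>. f \<eta> - t * g \<eta>) \<eta> = scan L f \<eta> - t * scan L g \<eta>"
    by (simp add: scan_def sum_subtractf diff_divide_distrib flip: sum_distrib_left)
qed

lemma scan_pow_diff: "(scan L ^^ k) (\<lambda>\<eta>. f \<eta> - g \<eta>) = (\<lambda>\<eta>. (scan L ^^ k) f \<eta> - (scan L ^^ k) g \<eta>)"
  using scan_linear[of L _ 1] by (induction k) auto

lemma inner_expand:
  assumes "bdd M A" "bdd M B" "bdd M C" "bdd M D"
  shows "(\<integral>\<eta>. (A \<eta> - t * B \<eta>) * (C \<eta> - t * D \<eta>) \<partial>P)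
    = (\<integral>\<eta>. A \<eta> * C \<eta> \<partial>P) - t * (\<integral>\<eta>. A \<eta> * D \<eta> \<partial>P) - t * (\<integral>\<eta>. B \<eta> * C \<eta> \<partial>P) + t\<^sup>2 * (\<integral>\<eta>. B \<eta> * D \<eta> \<partial>P)"
proof -
  note i = assms[THEN bdd_mult, THEN bdd_integrable]
  have "(\<integral>\<eta>. (A \<eta> - t * B \<eta>) * (C \<eta> - t * D \<eta>) \<partial>P)
    = (\<integral>\<eta>. A \<eta> * C \<eta> - t * (A \<eta> * D \<eta>) - t * (B \<eta> * C \<eta>) + t\<^sup>2 * (B \<eta> * D \<eta>) \<partial>P)"
    by (intro Bochner_Integration.integral_cong) (auto simp: algebra_simps power2_eq_square)
  also have "\<dots> = (\<integral>\<eta>. A \<eta> * C \<eta> \<partial>P) - t * (\<integral>\<eta>. A \<eta> * D \<eta> \<partial>P) - t * (\<integral>\<eta>. B \<eta> * C \<eta> \<partial>P) + t\<^sup>2 * (\<integral>\<eta>. B \<eta> * D \<eta> \<partial>P)"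
    using i(1)[OF assms(3)] i(1)[OF assms(4)] i(2)[OF assms(3)] i(2)[OF assms(4)] by simp
  finally show ?thesis .
qed

context
  fixes L :: "'v set"
  assumes L: "finite L" "L \<noteq> {}"
begin

text \<open>The energy \<open>a i\<close> of the \<open>i\<close>-th iterate is log-convex in \<open>i\<close> because \<open>scan L\<close> is symmetric. The
  decay of oscillations, whose prefactor depends badly on \<open>f\<close>, therefore forces every single ratio
  \<open>a (Suc i) / a i\<close> below the decay rate, and the prefactor disappears.\<close>

lemma scan_pow_poincare:
  assumes f: "bdd M f"
  shows "(\<integral>\<eta>. (f \<eta>)\<^sup>2 \<partial>P) - (\<integral>\<eta>. ((scan L ^^ k) f \<eta>)\<^sup>2 \<partial>P)
    \<le> 2 / (1 - K) * (\<Sum>x\<in>L. \<integral>\<eta>. (f \<eta> - heat_bath s x f \<eta>)\<^sup>2 \<partial>P)"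
proof -
  define F where "F i = (scan L ^^ i) f" for i
  define u where "u j = (\<integral>\<eta>. f \<eta> * F j \<eta> \<partial>P)" for j
  define a where "a i = u (2 * i) - u (Suc (2 * i))" for i
  let ?D = "\<Sum>x\<in>L. \<integral>\<eta>. (f \<eta> - heat_bath s x f \<eta>)\<^sup>2 \<partial>P" and ?q = "(rate L)\<^sup>2"
  have F: "bdd M (F i)" for i unfolding F_def by (rule bdd_scan_pow[OF L f])
  have scanF: "scan L (F i) = F (Suc i)" for i by (simp add: F_def)
  have inner: "(\<integral>\<eta>. F i \<eta> * F j \<eta> \<partial>P) = u (i + j)" for i j
    unfolding F_def u_def by (rule scan_pow_inner[OF L f])
  have expand: "(\<integral>\<eta>. (F i \<eta> - t * F j \<eta>) * (F k \<eta> - t * F l \<eta>) \<partial>P)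
      = u (i + k) - t * u (i + l) - t * u (j + k) + t\<^sup>2 * u (j + l)" for i j k l t
    by (simp only: inner_expand[OF F F F F] inner)
  have energy: "a i = (\<Sum>x\<in>L. \<integral>\<eta>. (F i \<eta> - heat_bath s x (F i) \<eta>)\<^sup>2 \<partial>P) / card L" for i
    using scan_energy[OF L F[of i]] by (simp add: scanF inner a_def mult_2)
  have a_nn: "0 \<le> a i" for i
    unfolding energy by (intro divide_nonneg_nonneg sum_nonneg integral_nonneg_AE) auto
  have a_bd: "a i \<le> (\<Sum>y\<in>L. w y * (2 * M))\<^sup>2 * ?q ^ i" for i
    unfolding energy F_def by (rule energy_decay[OF L f osc_bdd[OF f]])
  have lc: "(a (Suc i))\<^sup>2 \<le> a i * a (Suc (Suc i))" for i
  proof (rule discriminant_le)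
    fix t
    \<comment> \<open>The form \<open><g, (1 - T) h>\<close>, with \<open>T\<close> the scan, is
      positive semidefinite, and its value at \<open>F i\<close> and \<open>F (i + 2)\<close> is
      \<open>a (i + 1)\<close>. Positivity on this line is therefore the required Cauchy-Schwarz
      inequality.\<close>
    let ?h = "\<lambda>\<eta>. F i \<eta> - t * F (Suc (Suc i)) \<eta>"
    have idx: "i + i = 2 * i" "i + Suc (Suc i) = 2 * Suc i" "Suc (Suc i) + i = 2 * Suc i"
        "Suc (Suc i) + Suc (Suc i) = 2 * Suc (Suc i)" "i + Suc i = Suc (2 * i)"
        "i + Suc (Suc (Suc i)) = Suc (2 * Suc i)" "Suc (Suc i) + Suc i = Suc (2 * Suc i)"
        "Suc (Suc i) + Suc (Suc (Suc i)) = Suc (2 * Suc (Suc i))"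
      by auto
    have h: "bdd (M + \<bar>t\<bar> * M) ?h" by (intro bdd_diff bdd_scale F)
    have "0 \<le> (\<integral>\<eta>. ?h \<eta> * ?h \<eta> \<partial>P) - (\<integral>\<eta>. ?h \<eta> * scan L ?h \<eta> \<partial>P)"
      unfolding scan_energy[OF L h] by (intro divide_nonneg_nonneg sum_nonneg integral_nonneg_AE) auto
    moreover have "scan L ?h = (\<lambda>\<eta>. F (Suc i) \<eta> - t * F (Suc (Suc (Suc i))) \<eta>)"
      by (simp only: scan_linear scanF)
    moreover have "(\<integral>\<eta>. ?h \<eta> * ?h \<eta> \<partial>P) = u (2 * i) - 2 * t * u (2 * Suc i) + t\<^sup>2 * u (2 * Suc (Suc i))"
      unfolding expand idx by simp
    moreover have "(\<integral>\<eta>. ?h \<eta> * (F (Suc i) \<eta> - t * F (Suc (Suc (Suc i))) \<eta>) \<partial>P)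
        = u (Suc (2 * i)) - 2 * t * u (Suc (2 * Suc i)) + t\<^sup>2 * u (Suc (2 * Suc (Suc i)))"
      unfolding expand idx by simp
    ultimately show "0 \<le> a i - 2 * t * a (Suc i) + t\<^sup>2 * a (Suc (Suc i))"
      by (simp add: a_def right_diff_distrib)
  qed (rule a_nn)
  have ratio: "a (Suc i) \<le> ?q * a i" for i
    by (rule log_convex_ratio_le[OF a_nn lc a_bd]) simp
  have geo: "a i \<le> ?q ^ i * a 0" for i
  proof (induction i)
    case (Suc i)
    have "a (Suc i) \<le> ?q * (?q ^ i * a 0)" using ratio Suc by (rule order_trans[OF _ mult_left_mono]) simp
    then show ?case by (simp add: mult.assoc)
  qed simp
  \<comment> \<open>\<open>F i - F (Suc i)\<close> has nonnegative square norm, so the second of two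
    consecutive decrements of \<open>u\<close> is at most the first, which is
    \<open>a i\<close>.\<close>
  have step: "u (2 * i) - u (2 * Suc i) \<le> 2 * a i" for i
  proof -
    have "0 \<le> (\<integral>\<eta>. (F i \<eta> - 1 * F (Suc i) \<eta>) * (F i \<eta> - 1 * F (Suc i) \<eta>) \<partial>P)"
      by (intro integral_nonneg_AE) auto
    then show ?thesis
      unfolding expand by (simp add: a_def flip: mult_2)
  qed
  have "u 0 - u (2 * k) = (\<Sum>i<k. u (2 * i) - u (2 * Suc i))"
    by (induction k) auto
  also have "\<dots> \<le> (\<Sum>i<k. 2 * (?q ^ i * a 0))"
    by (intro sum_mono order_trans[OF step] mult_left_mono geo) auto
  also have "\<dots> = 2 * a 0 * (\<Sum>i<k. ?q ^ i)"
    by (simp add: sum_distrib_left mult_ac)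
  also have "\<dots> \<le> 2 * a 0 * (1 / (1 - rate L))"
  proof (intro mult_left_mono)
    have q: "?q \<le> rate L"
      using rate_bounds[OF L] by (simp add: power2_eq_square mult_left_le_one_le)
    then have "?q < 1" using rate_bounds[OF L] by linarith
    have "(\<Sum>i<k. ?q ^ i) = (1 - ?q ^ k) / (1 - ?q)"
      using \<open>?q < 1\<close> by (subst sum_gp_strict) auto
    also have "\<dots> \<le> 1 / (1 - rate L)"
      using q \<open>?q < 1\<close> rate_bounds[OF L] by (intro frac_le) auto
    finally show "(\<Sum>i<k. ?q ^ i) \<le> 1 / (1 - rate L)" .
  qed (use a_nn in auto)
  \<comment> \<open>\<open>1 - rate L\<close> is \<open>(1 - K) / card L\<close>, and its
    \<open>card L\<close> cancels the one in \<open>a 0\<close>. This makes the constant uniform in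
    \<open>L\<close>.\<close>
  also have "\<dots> = 2 / (1 - K) * ?D"
    using card_pos[OF L] K_less_1 energy[of 0] by (simp add: F_def rate_def[OF L])
  finally show ?thesis
    using inner[of k k, folded mult_2] inner[of 0 0] by (simp add: F_def power2_eq_square)
qed

text \<open>With \<open>g\<close> the scanned function, the square norm of \<open>g\<close> is the
  average of the inner products of \<open>g\<close> with the projections of \<open>f\<close>. Each
  is at most half the sum of the square norms of \<open>g\<close> and \<open>f\<close>, and the half
  belonging to \<open>g\<close> is absorbed on the left.\<close>

lemma scan_contraction:
  assumes f: "bdd M f"
  shows "(\<integral>\<eta>. (scan L f \<eta>)\<^sup>2 \<partial>P) \<le> (\<integral>\<eta>. (f \<eta>)\<^sup>2 \<partial>P)"
proof -
  let ?g = "scan L f"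
  note g = bdd_scan[OF L f]
  have "(\<integral>\<eta>. ?g \<eta> * heat_bath s x f \<eta> \<partial>P) \<le> ((\<integral>\<eta>. (?g \<eta>)\<^sup>2 \<partial>P) + (\<integral>\<eta>. (f \<eta>)\<^sup>2 \<partial>P)) / 2" for x
  proof -
    note h = bdd_heat_bath[OF f, of x]
    have "0 \<le> (\<integral>\<eta>. (?g \<eta> - 1 * heat_bath s x f \<eta>) * (?g \<eta> - 1 * heat_bath s x f \<eta>) \<partial>P)"
      by (intro integral_nonneg_AE) auto
    then have "2 * (\<integral>\<eta>. ?g \<eta> * heat_bath s x f \<eta> \<partial>P)
        \<le> (\<integral>\<eta>. ?g \<eta> * ?g \<eta> \<partial>P) + (\<integral>\<eta>. heat_bath s x f \<eta> * heat_bath s x f \<eta> \<partial>P)"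
      unfolding inner_expand[OF g h g h] using mult.commute[of "heat_bath s x f _" "?g _"] by simp
    moreover have "0 \<le> (\<integral>\<eta>. f \<eta> * f \<eta> \<partial>P) - (\<integral>\<eta>. f \<eta> * heat_bath s x f \<eta> \<partial>P)"
      unfolding heat_bath_energy[OF f] by (intro integral_nonneg_AE) auto
    moreover have "(\<integral>\<eta>. f \<eta> * heat_bath s x f \<eta> \<partial>P) = (\<integral>\<eta>. heat_bath s x f \<eta> * heat_bath s x f \<eta> \<partial>P)"
      using heat_bath_inner[OF f f, of x] by (simp only: mult.commute)
    ultimately show ?thesis by (simp add: power2_eq_square)
  qed
  then have "(\<Sum>x\<in>L. \<integral>\<eta>. ?g \<eta> * heat_bath s x f \<eta> \<partial>P)
      \<le> card L * (((\<integral>\<eta>. (?g \<eta>)\<^sup>2 \<partial>P) + (\<integral>\<eta>. (f \<eta>)\<^sup>2 \<partial>P)) / 2)"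
    by (rule sum_bounded_above)
  then have "(\<integral>\<eta>. ?g \<eta> * ?g \<eta> \<partial>P) \<le> ((\<integral>\<eta>. (?g \<eta>)\<^sup>2 \<partial>P) + (\<integral>\<eta>. (f \<eta>)\<^sup>2 \<partial>P)) / 2"
    unfolding inner_scan[OF L f g] using card_pos[OF L] by (simp add: divide_le_eq mult.commute)
  then show ?thesis by (simp add: power2_eq_square)
qed

lemma scan_pow_contraction:
  "bdd M f \<Longrightarrow> (\<integral>\<eta>. ((scan L ^^ k) f \<eta>)\<^sup>2 \<partial>P) \<le> (\<integral>\<eta>. (f \<eta>)\<^sup>2 \<partial>P)"
proof (induction k)
  case (Suc k)
  then show ?case using scan_contraction[OF bdd_scan_pow[OF L Suc(2), of k]] by simp
qed simp

end

section \<open>Cylinder functions and convergence to the mean\<close>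

definition depends_on :: "'v set \<Rightarrow> (('v \<Rightarrow> int) \<Rightarrow> real) \<Rightarrow> bool" where
  "depends_on S f \<longleftrightarrow> (\<forall>\<eta>\<in>space P. \<forall>\<zeta>\<in>space P. (\<forall>y\<in>S. \<eta> y = \<zeta> y) \<longrightarrow> f \<eta> = f \<zeta>)"

lemma depends_on_mono: "depends_on S f \<Longrightarrow> S \<subseteq> T \<Longrightarrow> depends_on T f"
  unfolding depends_on_def by (meson subsetD)

text \<open>Two configurations that differ at finitely many sites are joined by single flips, each
  costing one \<open>v x\<close>.\<close>

lemma osc_total:
  assumes v: "osc v f" and S: "finite S" "depends_on S f" and \<eta>: "\<eta> \<in> space P" and \<zeta>: "\<zeta> \<in> space P"
  shows "\<bar>f \<eta> - f \<zeta>\<bar> \<le> sum v S"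
proof -
  have *: "\<bar>f \<eta> - f \<zeta>\<bar> \<le> sum v A" if "finite A" "\<zeta> \<in> space P" "\<forall>y. y \<notin> A \<longrightarrow> \<eta> y = \<zeta> y" for A \<zeta>
    using that
  proof (induction A arbitrary: \<zeta> rule: finite_induct)
    case empty
    then have "\<eta> = \<zeta>" by auto
    then show ?case by simp
  next
    case (insert x A)
    let ?z = "\<zeta>(x := \<eta> x)"
    have x: "\<eta> x = 1 \<or> \<eta> x = -1" "\<zeta> x = 1 \<or> \<zeta> x = -1"
      using \<eta> insert.prems(1) by (auto simp: space_P)
    have z: "?z \<in> space P" using insert.prems(1) x(1) by simp
    have "\<bar>f \<eta> - f ?z\<bar> \<le> sum v A" using insert.prems by (intro insert.IH z) auto
    moreover have "\<bar>f ?z - f \<zeta>\<bar> \<le> v x"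
    proof (cases "\<eta> x = \<zeta> x")
      case True
      then have "?z = \<zeta>" by auto
      then show ?thesis using osc_nonneg[OF v] by simp
    next
      case False
      then have "\<eta> x = - \<zeta> x" using x by auto
      then show ?thesis using v insert.prems(1) unfolding osc_def by simp
    qed
    ultimately show ?case using insert.hyps by simp
  qed
  \<comment> \<open>This hybrid is indistinguishable from \<open>\<zeta>\<close> for
    \<open>f\<close> and differs from \<open>\<eta>\<close> only inside the finite set
    \<open>S\<close>.\<close>
  let ?z = "\<lambda>y. if y \<in> S then \<zeta> y else \<eta> y"
  have z: "?z \<in> space P" using \<eta> \<zeta> by (auto simp: space_P)
  have "f ?z = f \<zeta>" by (rule S(2)[unfolded depends_on_def, rule_format, OF z \<zeta>]) simp
  moreover have "\<bar>f \<eta> - f ?z\<bar> \<le> sum v S" by (intro * S z) auto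
  ultimately show ?thesis by simp
qed

lemma depends_on_heat_bath:
  assumes f: "depends_on T f" and T: "{y. c x y \<noteq> 0} \<subseteq> T"
  shows "depends_on T (heat_bath s x f)"
  unfolding depends_on_def
proof safe
  fix \<eta> \<zeta> assume *: "\<eta> \<in> space P" "\<zeta> \<in> space P" "\<forall>y\<in>T. \<eta> y = \<zeta> y"
  have "s x \<eta> = s x \<zeta>" using * T by (intro s_local) auto
  moreover have "f (\<eta>(x := a)) = f (\<zeta>(x := a))" if "a = 1 \<or> a = -1" for a
    using f * that unfolding depends_on_def by simp
  ultimately show "heat_bath s x f \<eta> = heat_bath s x f \<zeta>" by (simp add: heat_bath_def)
qed

lemma depends_on_scan_pow:
  assumes f: "depends_on T f" and T: "\<And>x. x \<in> L \<Longrightarrow> {y. c x y \<noteq> 0} \<subseteq> T"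
  shows "depends_on T ((scan L ^^ k) f)"
proof (induction k)
  case (Suc k)
  have *: "depends_on T (heat_bath s x ((scan L ^^ k) f))" if "x \<in> L" for x
    by (rule depends_on_heat_bath[OF Suc T[OF that]])
  show ?case unfolding depends_on_def
  proof safe
    fix \<eta> \<zeta> assume **: "\<eta> \<in> space P" "\<zeta> \<in> space P" "\<forall>y\<in>T. \<eta> y = \<zeta> y"
    have "(\<Sum>x\<in>L. heat_bath s x ((scan L ^^ k) f) \<eta>) = (\<Sum>x\<in>L. heat_bath s x ((scan L ^^ k) f) \<zeta>)"
      using * ** unfolding depends_on_def by (intro sum.cong) blast+
    then show "(scan L ^^ Suc k) f \<eta> = (scan L ^^ Suc k) f \<zeta>" by (simp add: scan_def)
  qed
qed (simp add: f)

text \<open>Inside \<open>L\<close> the oscillations die out geometrically. What has leaked sits at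
  sites of weight above \<open>R\<close>, and since the weighted total stays below its initial value
  \<open>I\<close>, the leaked sum is at most \<open>I / R\<close>.\<close>

lemma cylinder_ergodic:
  assumes g: "bdd M g" and S: "finite S" "depends_on S g" and e: "0 < e"
  obtains L k where "finite L" "L \<noteq> {}"
    "\<And>\<eta>. \<eta> \<in> space P \<Longrightarrow> \<bar>(scan L ^^ k) g \<eta> - (\<integral>\<eta>. g \<eta> \<partial>P)\<bar> \<le> e"
proof -
  define v where "v y = (if y \<in> S then 2 * M else 0)" for y
  have v: "osc v g" unfolding osc_def
  proof safe
    fix y \<eta> assume \<eta>: "\<eta> \<in> space P"
    show "\<bar>g (\<eta>(y := - \<eta> y)) - g \<eta>\<bar> \<le> v y"
    proof (cases "y \<in> S")
      case True
      then show ?thesis using osc_bdd[OF g] \<eta> by (simp add: osc_def v_def)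
    next
      case False
      then have "g (\<eta>(y := - \<eta> y)) = g \<eta>" using S(2) \<eta> flip_in_space[OF \<eta>] unfolding depends_on_def by (metis fun_upd_other)
      then show ?thesis using False by (simp add: v_def)
    qed
  qed
  define I where "I = (\<Sum>y\<in>S. w y * v y)"
  have I: "0 \<le> I" unfolding I_def using w_pos osc_nonneg[OF v] by (intro sum_nonneg mult_nonneg_nonneg)
  \<comment> \<open>Chosen to make \<open>I / R\<close> at most \<open>e / 2\<close>; the added 1
    keeps \<open>R\<close> positive when \<open>I = 0\<close>.\<close>
  define R where "R = 2 * I / e + 1"
  have R: "0 < R" "I / R \<le> e / 2" using I e by (auto simp: R_def field_simps add_pos_nonneg)
  \<comment> \<open>The site \<open>undefined\<close> makes \<open>L\<close> nonempty even if the
    other two sets are empty.\<close>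
  define L where "L = {y. w y \<le> R} \<union> insert undefined S"
  have L: "finite L" "L \<noteq> {}" using S w_finite by (auto simp: L_def)
  \<comment> \<open>\<open>T\<close> is closed under one step of influence from \<open>L\<close>, so
    every iterate still depends on \<open>T\<close> only.\<close>
  define T where "T = L \<union> (\<Union>x\<in>L. {y. c x y \<noteq> 0})"
  have T: "finite T" "L \<subseteq> T" using L c_finite by (auto simp: T_def)
  have sumI: "(\<Sum>y\<in>A. w y * v y) = I" if "finite A" "S \<subseteq> A" for A
    unfolding I_def using that by (intro sum.mono_neutral_right) (auto simp: v_def)
  obtain k where k: "rate L ^ k < e / (2 * (I + 1))"
    using real_arch_pow_inv[of "e / (2 * (I + 1))" "rate L"] rate_bounds[OF L] I e by auto
  have kI: "rate L ^ k * I \<le> e / 2"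
  proof -
    have "rate L ^ k * I \<le> e / (2 * (I + 1)) * I" using k I by (intro mult_right_mono) auto
    also have "\<dots> \<le> e / 2" using I e by (simp add: field_simps)
    finally show ?thesis .
  qed
  let ?v = "(scan_osc L ^^ k) v"
  have v0: "0 \<le> ?v y" for y by (intro scan_osc_pow_nonneg osc_nonneg[OF v])
  have "sum ?v T = sum ?v L + sum ?v (T - L)"
    using T by (simp add: sum.subset_diff[of L T])
  also have "sum ?v L \<le> (\<Sum>y\<in>L. w y * ?v y)"
    using mult_right_mono[OF w_ge_1 v0] by (intro sum_mono) simp
  also have "\<dots> \<le> rate L ^ k * (\<Sum>y\<in>L. w y * v y)"
    by (rule scan_osc_decay[OF L osc_nonneg[OF v]])
  also have "(\<Sum>y\<in>L. w y * v y) = I" using L by (intro sumI) (auto simp: L_def)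
  also note kI
  also have "sum ?v (T - L) \<le> (\<Sum>y\<in>T - L. w y * ?v y / R)"
  proof (intro sum_mono)
    fix y assume "y \<in> T - L"
    then have "R \<le> w y" by (auto simp: L_def)
    then show "?v y \<le> w y * ?v y / R" using R v0[of y] by (simp add: field_simps mult_right_mono)
  qed
  also have "\<dots> \<le> (\<Sum>y\<in>T. w y * ?v y / R)"
    using T R w_pos v0 by (intro sum_mono2) auto
  also have "\<dots> = (\<Sum>y\<in>T. w y * ?v y) / R" by (simp add: sum_divide_distrib)
  also have "\<dots> \<le> (\<Sum>y\<in>T. w y * v y) / R"
    using R by (intro divide_right_mono scan_osc_total[OF L T osc_nonneg[OF v]]) auto
  also have "(\<Sum>y\<in>T. w y * v y) = I" using T by (intro sumI) (auto simp: L_def T_def)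
  also note R(2)
  finally have tot: "sum ?v T \<le> e" by simp
  have dep: "depends_on T ((scan L ^^ k) g)"
    using S(2) by (intro depends_on_scan_pow) (auto simp: T_def L_def intro: depends_on_mono)
  note b = bdd_scan_pow[OF L g, of k]
  have "\<bar>(scan L ^^ k) g \<eta> - (\<integral>\<eta>. g \<eta> \<partial>P)\<bar> \<le> e" if \<eta>: "\<eta> \<in> space P" for \<eta>
  proof -
    \<comment> \<open>Any two values of the iterate differ by at most \<open>e\<close>, so each is
      within \<open>e\<close> of its integral, and the scan preserves integrals.\<close>
    have d: "\<bar>(scan L ^^ k) g \<eta> - (scan L ^^ k) g \<zeta>\<bar> \<le> e" if "\<zeta> \<in> space P" for \<zeta>
      using osc_total[OF osc_scan_pow[OF v] T(1) dep \<eta> that] tot by linarith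
    have "(\<integral>\<zeta>. (scan L ^^ k) g \<zeta> \<partial>P) \<le> (scan L ^^ k) g \<eta> + e"
      using d by (intro integral_le_const bdd_integrable[OF b] AE_I2) (smt (verit))
    moreover have "(scan L ^^ k) g \<eta> - e \<le> (\<integral>\<zeta>. (scan L ^^ k) g \<zeta> \<partial>P)"
      using d by (intro integral_ge_const bdd_integrable[OF b] AE_I2) (smt (verit))
    ultimately show ?thesis using scan_pow_integral[OF L g, of k] by linarith
  qed
  then show ?thesis using that L by blast
qed

section \<open>Cylinder approximation and the Poincare inequality\<close>

text \<open>Approximation is in the first mean, which suits induction over all integrable functions;
  a truncation later turns it into approximation in square mean.\<close>

definition approximable :: "(('v \<Rightarrow> int) \<Rightarrow> real) \<Rightarrow> bool" where
  "approximable f \<longleftrightarrow> (\<forall>e>0. \<exists>g S M. finite S \<and> bdd M g \<and> depends_on S g \<and> (\<integral>\<eta>. \<bar>f \<eta> - g \<eta>\<bar> \<partial>P) \<le> e)"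

lemma approximableI:
  assumes "finite S" "bdd M f" "depends_on S f" shows "approximable f"
  unfolding approximable_def using assms by (intro allI impI exI[of _ f] exI[of _ S] exI[of _ M]) simp

lemma approximable_cong:
  assumes "approximable f" "\<And>\<eta>. \<eta> \<in> space P \<Longrightarrow> f \<eta> = g \<eta>" shows "approximable g"
proof -
  have "(\<integral>\<eta>. \<bar>g \<eta> - h \<eta>\<bar> \<partial>P) = (\<integral>\<eta>. \<bar>f \<eta> - h \<eta>\<bar> \<partial>P)" for h
    using assms(2) by (intro Bochner_Integration.integral_cong) auto
  then show ?thesis using assms(1) unfolding approximable_def by simp
qed

lemma approximable_near:
  assumes f: "integrable P f"
    and near: "\<And>e. 0 < e \<Longrightarrow> \<exists>h. integrable P h \<and> approximable h \<and> (\<integral>\<eta>. \<bar>f \<eta> - h \<eta>\<bar> \<partial>P) \<le> e"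
  shows "approximable f"
  unfolding approximable_def
proof safe
  fix e :: real assume e: "0 < e"
  obtain h where h: "integrable P h" "approximable h" "(\<integral>\<eta>. \<bar>f \<eta> - h \<eta>\<bar> \<partial>P) \<le> e / 2"
    using near[of "e / 2"] e by auto
  obtain g S M where g: "finite S" "bdd M g" "depends_on S g" "(\<integral>\<eta>. \<bar>h \<eta> - g \<eta>\<bar> \<partial>P) \<le> e / 2"
    using h(2) e unfolding approximable_def by (meson half_gt_zero)
  have "(\<integral>\<eta>. \<bar>f \<eta> - g \<eta>\<bar> \<partial>P) \<le> (\<integral>\<eta>. \<bar>f \<eta> - h \<eta>\<bar> + \<bar>h \<eta> - g \<eta>\<bar> \<partial>P)"
    using f h(1) bdd_integrable[OF g(2)] by (intro integral_mono) auto
  also have "\<dots> = (\<integral>\<eta>. \<bar>f \<eta> - h \<eta>\<bar> \<partial>P) + (\<integral>\<eta>. \<bar>h \<eta> - g \<eta>\<bar> \<partial>P)"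
    using f h(1) bdd_integrable[OF g(2)] by (intro Bochner_Integration.integral_add) auto
  finally have "(\<integral>\<eta>. \<bar>f \<eta> - g \<eta>\<bar> \<partial>P) \<le> e" using h(3) g(4) by simp
  then show "\<exists>g S M. finite S \<and> bdd M g \<and> depends_on S g \<and> (\<integral>\<eta>. \<bar>f \<eta> - g \<eta>\<bar> \<partial>P) \<le> e"
    using g by blast
qed

lemma approximable_add:
  assumes f: "integrable P f" "approximable f" and g: "integrable P g" "approximable g"
  shows "approximable (\<lambda>\<eta>. f \<eta> + g \<eta>)"
  unfolding approximable_def
proof safe
  fix e :: real assume "0 < e"
  then have e: "0 < e / 2" by simp
  obtain f' S M where f': "finite S" "bdd M f'" "depends_on S f'" "(\<integral>\<eta>. \<bar>f \<eta> - f' \<eta>\<bar> \<partial>P) \<le> e / 2"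
    using f(2) e unfolding approximable_def by meson
  obtain g' T N where g': "finite T" "bdd N g'" "depends_on T g'" "(\<integral>\<eta>. \<bar>g \<eta> - g' \<eta>\<bar> \<partial>P) \<le> e / 2"
    using g(2) e unfolding approximable_def by meson
  note i = bdd_integrable[OF f'(2)] bdd_integrable[OF g'(2)]
  have "(\<integral>\<eta>. \<bar>f \<eta> + g \<eta> - (f' \<eta> + g' \<eta>)\<bar> \<partial>P) \<le> (\<integral>\<eta>. \<bar>f \<eta> - f' \<eta>\<bar> + \<bar>g \<eta> - g' \<eta>\<bar> \<partial>P)"
    using f(1) g(1) i by (intro integral_mono) auto
  also have "\<dots> = (\<integral>\<eta>. \<bar>f \<eta> - f' \<eta>\<bar> \<partial>P) + (\<integral>\<eta>. \<bar>g \<eta> - g' \<eta>\<bar> \<partial>P)"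
    using f(1) g(1) i by (intro Bochner_Integration.integral_add) auto
  finally have "(\<integral>\<eta>. \<bar>f \<eta> + g \<eta> - (f' \<eta> + g' \<eta>)\<bar> \<partial>P) \<le> e" using f'(4) g'(4) by simp
  moreover have "depends_on (S \<union> T) (\<lambda>\<eta>. f' \<eta> + g' \<eta>)"
    unfolding depends_on_def
  proof safe
    fix \<eta> \<zeta> assume *: "\<eta> \<in> space P" "\<zeta> \<in> space P" "\<forall>y\<in>S \<union> T. \<eta> y = \<zeta> y"
    have "f' \<eta> = f' \<zeta>" using f'(3) * unfolding depends_on_def by blast
    moreover have "g' \<eta> = g' \<zeta>" using g'(3) * unfolding depends_on_def by blast
    ultimately show "f' \<eta> + g' \<eta> = f' \<zeta> + g' \<zeta>" by simp
  qed
  ultimately show "\<exists>h S M. finite S \<and> bdd M h \<and> depends_on S h \<and> (\<integral>\<eta>. \<bar>f \<eta> + g \<eta> - h \<eta>\<bar> \<partial>P) \<le> e"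
    using bdd_add[OF f'(2) g'(2)] finite_UnI[OF f'(1) g'(1)]
    by (intro exI[of _ "\<lambda>\<eta>. f' \<eta> + g' \<eta>"] exI[of _ "S \<union> T"] exI[of _ "M + N"]) simp
qed

lemma approximable_scale:
  assumes "approximable f" shows "approximable (\<lambda>\<eta>. t * f \<eta>)"
  unfolding approximable_def
proof safe
  fix e :: real assume "0 < e"
  then have e: "0 < e / (\<bar>t\<bar> + 1)" by (simp add: add_nonneg_pos)
  obtain g S M where g: "finite S" "bdd M g" "depends_on S g" "(\<integral>\<eta>. \<bar>f \<eta> - g \<eta>\<bar> \<partial>P) \<le> e / (\<bar>t\<bar> + 1)"
    using assms e unfolding approximable_def by meson
  have "(\<integral>\<eta>. \<bar>t * f \<eta> - t * g \<eta>\<bar> \<partial>P) = \<bar>t\<bar> * (\<integral>\<eta>. \<bar>f \<eta> - g \<eta>\<bar> \<partial>P)"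
    by (simp add: abs_mult flip: right_diff_distrib)
  also have "\<dots> \<le> (\<bar>t\<bar> + 1) * (e / (\<bar>t\<bar> + 1))"
    using g(4) by (intro mult_mono) auto
  also have "\<dots> = e" by (simp add: add_nonneg_pos)
  finally have "(\<integral>\<eta>. \<bar>t * f \<eta> - t * g \<eta>\<bar> \<partial>P) \<le> e" .
  moreover have "depends_on S (\<lambda>\<eta>. t * g \<eta>)"
    using g(3) unfolding depends_on_def by metis
  ultimately show "\<exists>h S M. finite S \<and> bdd M h \<and> depends_on S h \<and> (\<integral>\<eta>. \<bar>t * f \<eta> - h \<eta>\<bar> \<partial>P) \<le> e"
    using bdd_scale[OF g(2), of t] g(1) by blast
qed

text \<open>The domination by \<open>2 * \<bar>f \<eta>\<bar>\<close> is the one supplied by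
  \<open>integrable_induct\<close>; it allows \<open>3 * \<bar>f \<eta>\<bar>\<close> to dominate
  the errors.\<close>

lemma approximable_lim:
  assumes s: "\<And>i. integrable P (u i)" "\<And>i. approximable (u i)"
    and lim: "\<And>\<eta>. \<eta> \<in> space P \<Longrightarrow> (\<lambda>i. u i \<eta>) \<longlonglongrightarrow> f \<eta>"
    and dom: "\<And>i \<eta>. \<eta> \<in> space P \<Longrightarrow> \<bar>u i \<eta>\<bar> \<le> 2 * \<bar>f \<eta>\<bar>"
    and f: "integrable P f"
  shows "approximable f"
proof (rule approximable_near[OF f])
  fix e :: real assume e: "0 < e"
  have "(\<lambda>i. \<integral>\<eta>. \<bar>f \<eta> - u i \<eta>\<bar> \<partial>P) \<longlonglongrightarrow> (\<integral>\<eta>. 0 \<partial>P)"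
  proof (rule integral_dominated_convergence[where w = "\<lambda>\<eta>. 3 * \<bar>f \<eta>\<bar>"])
    show "AE \<eta> in P. (\<lambda>i. \<bar>f \<eta> - u i \<eta>\<bar>) \<longlonglongrightarrow> 0"
    proof (rule AE_I2)
      fix \<eta> assume "\<eta> \<in> space P"
      from tendsto_rabs[OF tendsto_diff[OF tendsto_const[of "f \<eta>"] lim[OF this]]]
      show "(\<lambda>i. \<bar>f \<eta> - u i \<eta>\<bar>) \<longlonglongrightarrow> 0" by simp
    qed
    show "AE \<eta> in P. norm \<bar>f \<eta> - u i \<eta>\<bar> \<le> 3 * \<bar>f \<eta>\<bar>" for i
    proof (rule AE_I2)
      fix \<eta> assume "\<eta> \<in> space P"
      from dom[OF this, of i] show "norm \<bar>f \<eta> - u i \<eta>\<bar> \<le> 3 * \<bar>f \<eta>\<bar>" by simp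
    qed
  qed (use f s(1) in auto)
  then have "\<forall>\<^sub>F i in sequentially. (\<integral>\<eta>. \<bar>f \<eta> - u i \<eta>\<bar> \<partial>P) < e"
    using e by (intro order_tendstoD(2)) auto
  then obtain i where "(\<integral>\<eta>. \<bar>f \<eta> - u i \<eta>\<bar> \<partial>P) < e"
    using eventually_happens trivial_limit_sequentially by blast
  then show "\<exists>h. integrable P h \<and> approximable h \<and> (\<integral>\<eta>. \<bar>f \<eta> - h \<eta>\<bar> \<partial>P) \<le> e"
    using s by (intro exI[of _ "u i"]) simp
qed

text \<open>A pi-lambda argument: the generating sets are cylinders, whose indicators depend on
  finitely many spins, and complements and countable disjoint unions preserve
  approximability.\<close>

lemma approximable_indicator:
  assumes "A \<in> sets P" shows "approximable (indicator A)"
proof -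
  let ?M = "\<lambda>_::'v. count_space {-1, 1 :: int}"
  have ind: "integrable P (indicator B :: _ \<Rightarrow> real)" if "B \<in> sets P" for B
    using that by (intro integrable_const_bound[where B = 1]) (auto intro!: AE_I2 simp: indicator_def)
  have "A \<in> sigma_sets (\<Pi>\<^sub>E i\<in>UNIV. space (?M i)) (prod_algebra UNIV ?M)"
    using assms by (simp add: sets_P sets_PiM)
  with Int_stable_prod_algebra prod_algebra_sets_into_space show ?thesis
  proof (induction rule: sigma_sets_induct_disjoint)
    case (basic A)
    then obtain J E where J: "finite J" "J \<subseteq> UNIV" "A = prod_emb UNIV ?M J (Pi\<^sub>E J E)" "\<And>i. i \<in> J \<Longrightarrow> E i \<in> sets (?M i)"
      by (rule prod_algebraE) auto
    have "A \<in> sets P"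
      using basic unfolding sets_P sets_PiM by (rule sigma_sets.Basic)
    then have "bdd 1 (indicator A)" by (auto simp: bdd_def indicator_def)
    moreover have "depends_on J (indicator A)"
      unfolding depends_on_def J(3)
    proof safe
      fix \<eta> \<zeta> assume "\<eta> \<in> space P" "\<zeta> \<in> space P" "\<forall>y\<in>J. \<eta> y = \<zeta> y"
      then have "restrict \<eta> J = restrict \<zeta> J" "\<eta> \<in> (\<Pi>\<^sub>E i\<in>UNIV. space (?M i))" "\<zeta> \<in> (\<Pi>\<^sub>E i\<in>UNIV. space (?M i))"
        by (auto simp: space_P PiE_UNIV_domain)
      then show "indicator (prod_emb UNIV ?M J (Pi\<^sub>E J E)) \<eta> = (indicator (prod_emb UNIV ?M J (Pi\<^sub>E J E)) \<zeta> :: real)"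
        by (simp add: indicator_def prod_emb_def)
    qed
    ultimately show ?case using J(1) by (intro approximableI)
  next
    case empty
    show ?case by (rule approximableI[of "{}" 0]) (auto simp: bdd_def depends_on_def)
  next
    case (compl A)
    then have A: "A \<in> sets P" by (simp add: sets_P sets_PiM)
    have "approximable (\<lambda>\<eta>. 1 + (-1) * indicator A \<eta>)"
    proof (intro approximable_add approximable_scale compl)
      show "approximable (\<lambda>_. 1)" by (rule approximableI[of "{}" 1]) (auto simp: bdd_def depends_on_def)
    qed (use ind[OF A] in auto)
    then show ?case
      by (rule approximable_cong) (auto simp: indicator_def space_P PiE_UNIV_domain)
  next
    case (union A)
    then have A: "A i \<in> sets P" for i by (auto simp: sets_P sets_PiM)
    have part: "integrable P (\<lambda>\<eta>. \<Sum>i<n. indicator (A i) \<eta> :: real)" for n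
      using ind[OF A] by auto
    show ?case
    proof (rule approximable_lim[of "\<lambda>n \<eta>. \<Sum>i<n. indicator (A i) \<eta>"])
      show "approximable (\<lambda>\<eta>. \<Sum>i<n. indicator (A i) \<eta>)" for n
      proof (induction n)
        case 0
        show ?case by (rule approximableI[of "{}" 0]) (auto simp: bdd_def depends_on_def)
      next
        case (Suc n)
        show ?case using approximable_add[OF part Suc ind[OF A] union(3), of n] by (simp add: add.commute)
      qed
      \<comment> \<open>Disjointness keeps the partial sums at most 1, so dominated convergence
        applies.\<close>
      have *: "(\<Sum>i<n. indicator (A i) \<eta>) = (indicator (\<Union>i<n. A i) \<eta> :: real)" for n \<eta>
        using union(1) by (subst indicator_UN_disjoint) (auto simp: disjoint_family_on_def)
      show "(\<lambda>n. \<Sum>i<n. indicator (A i) \<eta>) \<longlonglongrightarrow> (indicator (\<Union>i. A i) \<eta> :: real)" for \<eta>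
        unfolding * by (rule LIMSEQ_indicator_UN)
      show "\<bar>\<Sum>i<n. indicator (A i) \<eta>\<bar> \<le> 2 * \<bar>indicator (\<Union>i. A i) \<eta> :: real\<bar>" for n \<eta>
        unfolding * by (auto simp: indicator_def)
    qed (use part ind A in auto)
  qed
qed

lemma integrable_approximable: "integrable P f \<Longrightarrow> approximable f"
proof (induction rule: integrable_induct)
  case (base A t)
  then show ?case using approximable_scale[OF approximable_indicator, of A t] by (simp add: mult.commute)
next
  case (add f g)
  then show ?case by (intro approximable_add)
next
  case (lim f u)
  then show ?case by (intro approximable_lim[of u f]) auto
qed

text \<open>Clamping \<open>g\<close> to the range of \<open>f\<close> brings it no further from
  \<open>f\<close> and bounds the error by \<open>2 * M\<close>. The square of the error is then at
  most \<open>2 * M\<close> times the absolute error. The denominator \<open>2 * M + 1\<close>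
  covers \<open>M = 0\<close>.\<close>

lemma cylinder_dense:
  assumes f: "bdd M f" and e: "0 < e"
  obtains g S where "finite S" "bdd M g" "depends_on S g" "(\<integral>\<eta>. (f \<eta> - g \<eta>)\<^sup>2 \<partial>P) \<le> e"
proof -
  obtain \<eta>\<^sub>0 where "\<eta>\<^sub>0 \<in> space P" using not_empty by blast
  then have M: "0 \<le> M" using f unfolding bdd_def by (meson abs_ge_zero order_trans)
  have e': "0 < e / (2 * M + 1)" using e M by (simp add: add_nonneg_pos)
  obtain g S N where g: "finite S" "bdd N g" "depends_on S g" "(\<integral>\<eta>. \<bar>f \<eta> - g \<eta>\<bar> \<partial>P) \<le> e / (2 * M + 1)"
    using integrable_approximable[OF bdd_integrable[OF f]] e' unfolding approximable_def by meson
  define h where "h \<eta> = max (- M) (min M (g \<eta>))" for \<eta>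
  have h: "bdd M h"
    using g(2) M unfolding bdd_def h_def by (auto simp: max_def min_def abs_if)
  have hdep: "depends_on S h" using g(3) unfolding depends_on_def h_def by metis
  have pt: "(f \<eta> - h \<eta>)\<^sup>2 \<le> 2 * M * \<bar>f \<eta> - g \<eta>\<bar>" if "\<eta> \<in> space P" for \<eta>
  proof -
    have b: "\<bar>f \<eta>\<bar> \<le> M" "\<bar>h \<eta>\<bar> \<le> M" using f h that by (auto simp: bdd_def)
    then have "\<bar>f \<eta> - h \<eta>\<bar> \<le> 2 * M" "\<bar>f \<eta> - h \<eta>\<bar> \<le> \<bar>f \<eta> - g \<eta>\<bar>"
      by (auto simp: h_def max_def min_def abs_if split: if_splits)
    then have "\<bar>f \<eta> - h \<eta>\<bar> * \<bar>f \<eta> - h \<eta>\<bar> \<le> 2 * M * \<bar>f \<eta> - g \<eta>\<bar>" by (intro mult_mono) auto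
    then show ?thesis by (simp add: power2_eq_square)
  qed
  have "(\<integral>\<eta>. (f \<eta> - h \<eta>)\<^sup>2 \<partial>P) \<le> (\<integral>\<eta>. 2 * M * \<bar>f \<eta> - g \<eta>\<bar> \<partial>P)"
  proof (rule integral_mono[OF _ _ pt])
    show "integrable P (\<lambda>\<eta>. (f \<eta> - h \<eta>)\<^sup>2)"
      using bdd_integrable[OF bdd_mult[OF bdd_diff[OF f h] bdd_diff[OF f h]]] by (simp add: power2_eq_square)
    show "integrable P (\<lambda>\<eta>. 2 * M * \<bar>f \<eta> - g \<eta>\<bar>)"
      using bdd_integrable[OF f] bdd_integrable[OF g(2)] by auto
  qed
  also have "\<dots> = 2 * M * (\<integral>\<eta>. \<bar>f \<eta> - g \<eta>\<bar> \<partial>P)" by simp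
  also have "\<dots> \<le> (2 * M + 1) * (e / (2 * M + 1))"
    using g(4) M by (intro mult_mono) auto
  also have "\<dots> = e" using M by (simp add: add_nonneg_pos)
  finally show ?thesis using that[OF g(1) h hdep] by blast
qed

text \<open>Split \<open>f\<close> as \<open>f - g\<close> plus a cylinder function
  \<open>g\<close>. The first part stays small because the scan is a contraction; the second becomes
  nearly constant, and the constant is small because \<open>f\<close> is centred.\<close>

lemma scan_ergodic:
  assumes f: "bdd M f" and mean: "(\<integral>\<eta>. f \<eta> \<partial>P) = 0" and e: "0 < e"
  obtains L k where "finite L" "L \<noteq> {}" "(\<integral>\<eta>. ((scan L ^^ k) f \<eta>)\<^sup>2 \<partial>P) \<le> e"
proof -
  \<comment> \<open>The shares add up to \<open>e\<close>: \<open>e / 6\<close> from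
    \<open>f - g\<close>, \<open>e / 3\<close> from the squared mean of \<open>g\<close>, and
    \<open>e / 2\<close> from its deviation, with \<open>r\<close> squared equal to
    \<open>e / 8\<close>.\<close>
  have "0 < e / 12" using e by simp
  then obtain g S where g: "finite S" "bdd M g" "depends_on S g" "(\<integral>\<eta>. (f \<eta> - g \<eta>)\<^sup>2 \<partial>P) \<le> e / 12"
    using cylinder_dense[OF f] by blast
  define r where "r = sqrt (e / 8)"
  have r: "0 < r" "r\<^sup>2 = e / 8" using e by (auto simp: r_def)
  obtain L k where L: "finite L" "L \<noteq> {}"
    and Lk: "\<And>\<eta>. \<eta> \<in> space P \<Longrightarrow> \<bar>(scan L ^^ k) g \<eta> - (\<integral>\<eta>. g \<eta> \<partial>P)\<bar> \<le> r"
    using cylinder_ergodic[OF g(2,1,3) r(1)] by blast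
  let ?m = "\<integral>\<eta>. g \<eta> \<partial>P" and ?d = "\<lambda>\<eta>. f \<eta> - g \<eta>"
  note d = bdd_diff[OF f g(2)]
  have int2: "integrable P (\<lambda>\<eta>. (h \<eta>)\<^sup>2)" if "bdd N h" for N h
    using bdd_integrable[OF bdd_mult[OF that that]] by (simp add: power2_eq_square)
  have "(\<integral>\<eta>. ?d \<eta> \<partial>P)\<^sup>2 \<le> (\<integral>\<eta>. (?d \<eta>)\<^sup>2 \<partial>P)"
    using variance_positive[of ?d] variance_eq[OF bdd_integrable[OF d] int2[OF d]] by simp
  moreover have "(\<integral>\<eta>. ?d \<eta> \<partial>P) = - ?m"
    using bdd_integrable[OF f] bdd_integrable[OF g(2)] mean by simp
  ultimately have m: "?m\<^sup>2 \<le> e / 12" using g(4) by simp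
  note dk = bdd_scan_pow[OF L d, of k]
  have pt: "((scan L ^^ k) f \<eta>)\<^sup>2 \<le> 2 * ((scan L ^^ k) ?d \<eta>)\<^sup>2 + (e / 3 + e / 2)" if "\<eta> \<in> space P" for \<eta>
  proof -
    let ?G = "(scan L ^^ k) g \<eta>" and ?D = "(scan L ^^ k) ?d \<eta>"
    have sq: "(a + b)\<^sup>2 \<le> 2 * a\<^sup>2 + 2 * b\<^sup>2" for a b :: real
      using zero_le_power2[of "a - b"] by (simp add: power2_eq_square algebra_simps)
    have "(scan L ^^ k) f \<eta> = ?D + ?G" by (simp add: scan_pow_diff)
    moreover have "?G\<^sup>2 \<le> 2 * (?G - ?m)\<^sup>2 + 2 * ?m\<^sup>2" using sq[of "?G - ?m" ?m] by simp
    moreover have "(?G - ?m)\<^sup>2 \<le> r\<^sup>2" using Lk[OF that] r by (simp add: abs_le_square_iff[symmetric])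
    ultimately show ?thesis using sq[of ?D ?G] m r(2) by simp
  qed
  have "(\<integral>\<eta>. ((scan L ^^ k) f \<eta>)\<^sup>2 \<partial>P) \<le> (\<integral>\<eta>. 2 * ((scan L ^^ k) ?d \<eta>)\<^sup>2 + (e / 3 + e / 2) \<partial>P)"
    using int2[OF dk] int2[OF bdd_scan_pow[OF L f]] by (intro integral_mono[OF _ _ pt]) auto
  also have "\<dots> = 2 * (\<integral>\<eta>. ((scan L ^^ k) ?d \<eta>)\<^sup>2 \<partial>P) + (e / 3 + e / 2)"
    using int2[OF dk] by (simp add: prob_space)
  also have "\<dots> \<le> e"
    using scan_pow_contraction[OF L d, of k] g(4) by simp
  finally show ?thesis using that L by blast
qed

text \<open>\<open>L\<close> depends on \<open>f\<close> and \<open>e\<close> but the constant does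
  not, which suffices because the Dirichlet form is a supremum over finite sets of sites.\<close>

theorem poincare_bounded:
  assumes f: "bdd M f" and e: "0 < e"
  obtains L where "finite L"
    "(\<integral>\<eta>. (f \<eta> - (\<integral>\<xi>. f \<xi> \<partial>P))\<^sup>2 \<partial>P) \<le> 2 / (1 - K) * (\<Sum>x\<in>L. \<integral>\<eta>. (f (\<eta>(x := - \<eta> x)) - f \<eta>)\<^sup>2 \<partial>P) + e"
proof -
  let ?m = "\<integral>\<xi>. f \<xi> \<partial>P" and ?f = "\<lambda>\<eta>. f \<eta> - (\<integral>\<xi>. f \<xi> \<partial>P)"
  have "bdd \<bar>?m\<bar> (\<lambda>_. ?m)" by (simp add: bdd_def)
  note f0 = bdd_diff[OF f this]
  have "(\<integral>\<eta>. ?f \<eta> \<partial>P) = 0" using bdd_integrable[OF f] by (simp add: prob_space)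
  then obtain L k where L: "finite L" "L \<noteq> {}" "(\<integral>\<eta>. ((scan L ^^ k) ?f \<eta>)\<^sup>2 \<partial>P) \<le> e"
    using scan_ergodic[OF f0 _ e] by blast
  have "(\<integral>\<eta>. (?f \<eta> - heat_bath s x ?f \<eta>)\<^sup>2 \<partial>P) \<le> (\<integral>\<eta>. (f (\<eta>(x := - \<eta> x)) - f \<eta>)\<^sup>2 \<partial>P)" for x
  proof (rule integral_mono)
    note b = bdd_diff[OF f0 bdd_heat_bath[OF f0, of x]]
    show "integrable P (\<lambda>\<eta>. (?f \<eta> - heat_bath s x ?f \<eta>)\<^sup>2)"
      using bdd_integrable[OF bdd_mult[OF b b]] by (simp add: power2_eq_square)
    have "(\<lambda>\<eta>. f (\<eta>(x := - \<eta> x))) \<in> borel_measurable P"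
    proof -
      have fm: "f \<in> borel_measurable P" using f by (simp add: bdd_def)
      \<comment> \<open>A flip is measurable since, by cases on the present spin, it is an update to
        a constant.\<close>
      have "(\<lambda>\<eta>. if \<eta> x = 1 then f (\<eta>(x := -1)) else f (\<eta>(x := 1))) \<in> borel_measurable P"
      proof (rule measurable_If)
        have "(\<lambda>\<eta>. \<eta> x) \<in> measurable P (count_space {-1, 1})"
          using measurable_component_singleton[of x UNIV "\<lambda>_. count_space {-1, 1::int}"] sets_P
            measurable_cong_sets by blast
        then have "(\<lambda>\<eta>. \<eta> x) -` {1} \<inter> space P \<in> sets P" by (rule measurable_sets) auto
        then show "{\<eta> \<in> space P. \<eta> x = 1} \<in> sets P" by (simp add: vimage_def Int_def conj_commute)
      qed (auto intro!: measurable_compose[OF update_measurable fm])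
      then show ?thesis
        by (rule measurable_cong[THEN iffD1, rotated]) (auto simp: space_P dest: spec[of _ x])
    qed
    then have "bdd M (\<lambda>\<eta>. f (\<eta>(x := - \<eta> x)))" using f by (auto simp: bdd_def)
    note b = bdd_diff[OF this f]
    show "integrable P (\<lambda>\<eta>. (f (\<eta>(x := - \<eta> x)) - f \<eta>)\<^sup>2)"
      using bdd_integrable[OF bdd_mult[OF b b]] by (simp add: power2_eq_square)
    show "(?f \<eta> - heat_bath s x ?f \<eta>)\<^sup>2 \<le> (f (\<eta>(x := - \<eta> x)) - f \<eta>)\<^sup>2" if "\<eta> \<in> space P" for \<eta>
      using heat_bath_diff[OF that, of ?f x] by (simp add: abs_le_square_iff[symmetric])
  qed
  then have "(\<Sum>x\<in>L. \<integral>\<eta>. (?f \<eta> - heat_bath s x ?f \<eta>)\<^sup>2 \<partial>P)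
      \<le> (\<Sum>x\<in>L. \<integral>\<eta>. (f (\<eta>(x := - \<eta> x)) - f \<eta>)\<^sup>2 \<partial>P)" by (rule sum_mono)
  then have "2 / (1 - K) * (\<Sum>x\<in>L. \<integral>\<eta>. (?f \<eta> - heat_bath s x ?f \<eta>)\<^sup>2 \<partial>P)
      \<le> 2 / (1 - K) * (\<Sum>x\<in>L. \<integral>\<eta>. (f (\<eta>(x := - \<eta> x)) - f \<eta>)\<^sup>2 \<partial>P)"
    using K_less_1 by (intro mult_left_mono) auto
  then show ?thesis using scan_pow_poincare[OF L(1,2) f0, of k] L(3) by (intro that[OF L(1)]) linarith
qed

end

section \<open>The Markov random field satisfies the Dobrushin condition\<close>

lemma not_nbr_self: "\<not> nbr x x"
  by (simp add: nbr_def)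

text \<open>Integer differences of total size 1 are concentrated in one coordinate, so a neighbour
  is given by a direction and a sign.\<close>

lemma nbr_set_bound:
  fixes x :: "int ^ 'd"
  shows "finite {y. nbr x y} \<and> card {y. nbr x y} \<le> 2 * CARD('d)"
proof -
  let ?f = "\<lambda>(i, t). \<chi> j. if j = i then x $ j + t else x $ j" and ?B = "(UNIV :: 'd set) \<times> {1, -1 :: int}"
  have sub: "{y. nbr x y} \<subseteq> ?f ` ?B"
  proof safe
    fix y assume n: "nbr x y"
    then obtain i where i: "x $ i \<noteq> y $ i" unfolding nbr_def by force
    have "(\<Sum>j\<in>UNIV. \<bar>x $ j - y $ j\<bar>) = \<bar>x $ i - y $ i\<bar> + (\<Sum>j\<in>UNIV - {i}. \<bar>x $ j - y $ j\<bar>)"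
      by (rule sum.remove) auto
    moreover have "0 \<le> (\<Sum>j\<in>UNIV - {i}. \<bar>x $ j - y $ j\<bar>)" by (rule sum_nonneg) simp
    ultimately have one: "\<bar>x $ i - y $ i\<bar> = 1" and zero: "(\<Sum>j\<in>UNIV - {i}. \<bar>x $ j - y $ j\<bar>) = 0"
      using n i unfolding nbr_def by linarith+
    have "x $ j = y $ j" if "j \<noteq> i" for j
      using zero that by (subst (asm) sum_nonneg_eq_0_iff) auto
    then have "y = ?f (i, y $ i - x $ i)" by (auto simp: vec_eq_iff)
    moreover have "(i, y $ i - x $ i) \<in> ?B" using one by auto
    ultimately show "y \<in> ?f ` ?B" by (rule image_eqI)
  qed
  have "card {y. nbr x y} \<le> card (?f ` ?B)" using sub by (intro card_mono) auto
  also have "\<dots> \<le> card ?B" by (rule card_image_le) auto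
  also have "\<dots> = 2 * CARD('d)" by (simp add: card_cartesian_product)
  finally show ?thesis using finite_subset[OF sub] by auto
qed

text \<open>The exponent of the weight \<open>2 ^ l1 x\<close>: it changes by at most 1 along an
  edge and has finite balls, as the weight conditions demand.\<close>

definition l1 :: "int ^ 'd \<Rightarrow> nat" where "l1 x = nat (\<Sum>i\<in>UNIV. \<bar>x $ i\<bar>)"

lemma l1_nbr: assumes "nbr x y" shows "l1 y \<le> Suc (l1 x)"
proof -
  have "(\<Sum>i\<in>UNIV. \<bar>y $ i\<bar>) \<le> (\<Sum>i\<in>UNIV. \<bar>x $ i\<bar> + \<bar>x $ i - y $ i\<bar>)" by (rule sum_mono) simp
  then show ?thesis using assms by (simp add: l1_def nbr_def sum.distrib)
qed

lemma finite_l1_ball: "finite {x :: int ^ 'd. l1 x \<le> n}"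
proof -
  have "vec_nth ` {x :: int ^ 'd. l1 x \<le> n} \<subseteq> (UNIV \<rightarrow>\<^sub>E {- int n..int n})"
  proof (auto simp: PiE_UNIV_domain)
    fix x :: "int ^ 'd" and i assume "l1 x \<le> n"
    moreover have "\<bar>x $ i\<bar> \<le> (\<Sum>i\<in>UNIV. \<bar>x $ i\<bar>)" by (rule member_le_sum) auto
    ultimately have "\<bar>x $ i\<bar> \<le> int n" by (simp add: l1_def)
    then show "- int n \<le> x $ i" "x $ i \<le> int n" by auto
  qed
  then have "finite (vec_nth ` {x :: int ^ 'd. l1 x \<le> n})"
    by (rule finite_subset) (auto intro: finite_PiE)
  then show ?thesis by (rule finite_imageD) (auto simp: inj_on_def vec_eq_iff)
qed

lemma nbr_set_finite: "finite {y. nbr x y}" and nbr_set_card: "card {y. nbr (x :: int ^ 'd) y} \<le> 2 * CARD('d)"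
  using nbr_set_bound[of x] by auto

section \<open>The single-site conditional probabilities\<close>

lemma space_Omega: "space (Omega :: (int ^ 'd \<Rightarrow> int) measure) = {\<eta>. \<forall>y. \<eta> y = -1 \<or> \<eta> y = 1}"
  by (auto simp: Omega_def space_PiM PiE_UNIV_domain)

lemma spec_cong: "(\<And>y. nbr x y \<Longrightarrow> \<eta> y = \<zeta> y) \<Longrightarrow> spec \<beta> h J x \<eta> = spec \<beta> h J x \<zeta>"
  unfolding spec_def Let_def by (metis (no_types, lifting) mem_Collect_eq sum.cong)

lemma spec_logistic:
  fixes x :: "int ^ 'd"
  shows "spec \<beta> h J x \<eta> = 1 / (1 + exp (- 2 * \<beta> * h) * exp (- 2 * \<beta> * J * real_of_int (\<Sum>y | nbr x y. \<eta> y)))"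
proof -
  define S where "S = real_of_int (\<Sum>y | nbr x y. \<eta> y)"
  define u where "u = \<beta> * h + \<beta> * J * S"
  have "2 * cosh u = exp u + exp (- u)" by (simp add: cosh_field_def)
  moreover have "exp (\<beta> * h) * exp (\<beta> * J * S) = exp u" by (simp add: u_def exp_add)
  ultimately have "spec \<beta> h J x \<eta> = exp u / (exp u + exp (- u))"
    unfolding spec_def S_def[symmetric] Let_def u_def[symmetric] by simp
  also have "\<dots> = exp u / (exp u * (1 + exp (- 2 * u)))"
    by (simp add: distrib_left exp_add[symmetric])
  also have "\<dots> = 1 / (1 + exp (- 2 * u))"
    by simp
  also have "exp (- 2 * u) = exp (- 2 * \<beta> * h) * exp (- 2 * \<beta> * J * S)"
    by (simp add: u_def exp_add[symmetric] algebra_simps)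
  finally show ?thesis by (simp add: S_def)
qed

lemma spec_range: "0 \<le> spec \<beta> h J x \<eta> \<and> spec \<beta> h J x \<eta> \<le> 1"
  unfolding spec_logistic by (auto simp: add_pos_pos divide_le_eq intro: add_nonneg_nonneg)

text \<open>In logistic form the probability is monotone in the neighbour sum, which lies between
  \<open>-2 * d\<close> and \<open>2 * d\<close>. The gap between the two extreme values is at most
  the percolation parameter, which thereby bounds the influence of any one neighbour.\<close>

lemma spec_diff_le:
  fixes x :: "int ^ 'd"
  assumes \<beta>: "0 < \<beta>" and J: "J \<in> {-1, 1}" and \<eta>: "\<eta> \<in> space Omega" and \<zeta>: "\<zeta> \<in> space Omega"
  shows "\<bar>spec \<beta> h J x \<eta> - spec \<beta> h J x \<zeta>\<bar>
    \<le> exp (- 2 * \<beta> * h) * (exp (4 * \<beta> * CARD('d)) - exp (- 4 * \<beta> * CARD('d)))"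
proof -
  let ?a = "exp (- 2 * \<beta> * h)" and ?E = "exp (4 * \<beta> * CARD('d))"
  have bounds: "1 / (1 + ?a * ?E) \<le> spec \<beta> h J x \<xi> \<and> spec \<beta> h J x \<xi> \<le> 1 / (1 + ?a * inverse ?E)"
    if "\<xi> \<in> space Omega" for \<xi>
  proof -
    define S where "S = real_of_int (\<Sum>y | nbr x y. \<xi> y)"
    have "\<bar>\<Sum>y | nbr x y. \<xi> y\<bar> \<le> (\<Sum>y | nbr x y. 1)"
    proof (intro order_trans[OF sum_abs] sum_mono)
      fix y
      have "\<xi> y = -1 \<or> \<xi> y = 1" using that by (simp add: space_Omega)
      then show "\<bar>\<xi> y\<bar> \<le> 1" by auto
    qed
    also have "\<dots> \<le> 2 * int CARD('d)" using nbr_set_card[of x] by simp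
    finally have "\<bar>S\<bar> \<le> 2 * CARD('d)" unfolding S_def by linarith
    then have JS: "\<bar>J * S\<bar> \<le> 2 * CARD('d)" using J by (auto simp: abs_mult)
    then have "(2 * \<beta>) * (J * S) \<le> (2 * \<beta>) * (2 * CARD('d))" "(2 * \<beta>) * (- (J * S)) \<le> (2 * \<beta>) * (2 * CARD('d))"
      using \<beta> by (intro mult_left_mono; linarith)+
    then have "exp (- 2 * \<beta> * J * S) \<le> ?E" "inverse ?E \<le> exp (- 2 * \<beta> * J * S)"
      unfolding exp_minus[symmetric] by (auto simp: algebra_simps)
    then show ?thesis
      unfolding spec_logistic S_def[symmetric]
      by (intro conjI divide_left_mono add_left_mono mult_left_mono mult_pos_pos add_pos_pos) auto
  qed
  have diff_inv: "1 / (1 + X) - 1 / (1 + Y) = (Y - X) / ((1 + X) * (1 + Y))" if "0 < X" "0 < Y" for X Y :: real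
    using that by (simp add: divide_simps)
  have "1 / (1 + ?a * inverse ?E) - 1 / (1 + ?a * ?E) = ?a * (?E - inverse ?E) / ((1 + ?a * inverse ?E) * (1 + ?a * ?E))"
    using diff_inv[of "?a * inverse ?E" "?a * ?E"] by (simp add: right_diff_distrib)
  also have "\<dots> \<le> ?a * (?E - inverse ?E) / 1"
  proof (rule divide_left_mono)
    have "1 * 1 \<le> (1 + ?a * inverse ?E) * (1 + ?a * ?E)" by (intro mult_mono) auto
    then show "1 \<le> (1 + ?a * inverse ?E) * (1 + ?a * ?E)" by simp
    have "inverse ?E \<le> ?E" using \<beta> unfolding exp_minus[symmetric] by simp
    then show "0 \<le> ?a * (?E - inverse ?E)" by simp
  qed (auto intro!: mult_pos_pos add_pos_pos)
  finally have "1 / (1 + ?a * inverse ?E) - 1 / (1 + ?a * ?E) \<le> ?a * (?E - inverse ?E)" by simp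
  moreover have "exp (- 4 * \<beta> * CARD('d)) = inverse ?E" by (simp add: exp_minus[symmetric])
  ultimately show ?thesis using bounds[OF \<eta>] bounds[OF \<zeta>] by (simp only:) linarith
qed

lemma coordinate_measurable: "y \<in> I \<Longrightarrow> (\<lambda>\<eta>. \<eta> y) \<in> measurable (PiM I (\<lambda>_. count_space {-1, 1 :: int})) (count_space {-1, 1})"
  by (rule measurable_component_singleton)

lemma spec_measurable_PiM:
  fixes x :: "int ^ 'd"
  assumes "\<And>y. nbr x y \<Longrightarrow> y \<in> I"
  shows "spec \<beta> h J x \<in> borel_measurable (PiM I (\<lambda>_. count_space {-1, 1}))"
proof -
  have *: "(\<lambda>\<eta>. real_of_int (\<eta> y)) \<in> borel_measurable (PiM I (\<lambda>_. count_space {-1, 1}))" if "nbr x y" for y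
    by (rule measurable_compose[OF coordinate_measurable[OF assms[OF that]]]) simp
  have "(\<lambda>\<eta>. \<Sum>y | nbr x y. real_of_int (\<eta> y)) \<in> borel_measurable (PiM I (\<lambda>_. count_space {-1, 1}))"
    using * by (intro borel_measurable_sum) auto
  then show ?thesis unfolding spec_logistic[abs_def] of_int_sum by measurable
qed

lemma restrict_outside_measurable:
  "(\<lambda>\<eta>. restrict \<eta> (UNIV - {x})) \<in> measurable (outside_sa x) (PiM (UNIV - {x}) (\<lambda>_. count_space {-1, 1}))"
  unfolding outside_sa_def
  by (rule measurable_vimage_algebra1) (auto simp: space_Omega space_PiM)

lemma outside_measurableI:
  fixes g :: "(int ^ 'd \<Rightarrow> int) \<Rightarrow> real"
  assumes "g \<in> borel_measurable (PiM (UNIV - {x}) (\<lambda>_. count_space {-1, 1}))"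
    and "\<And>\<eta>. \<eta> \<in> space Omega \<Longrightarrow> f \<eta> = g (restrict \<eta> (UNIV - {x}))"
  shows "f \<in> borel_measurable (outside_sa x)"
proof -
  have "(\<lambda>\<eta>. g (restrict \<eta> (UNIV - {x}))) \<in> borel_measurable (outside_sa x)"
    by (rule measurable_compose[OF restrict_outside_measurable assms(1)])
  then show ?thesis
    by (rule measurable_cong[THEN iffD1, rotated]) (simp add: assms(2) outside_sa_def)
qed

text \<open>No site is its own neighbour, so erasing the spin at \<open>x\<close> leaves the
  neighbour sum unchanged.\<close>

lemma spec_outside_measurable: "spec \<beta> h J x \<in> borel_measurable (outside_sa x)"
  by (rule outside_measurableI[where g = "spec \<beta> h J x", OF spec_measurable_PiM])
    (auto simp: not_nbr_self intro!: spec_cong)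

lemma update_outside_measurable:
  fixes f :: "(int ^ 'd \<Rightarrow> int) \<Rightarrow> real"
  assumes f: "f \<in> borel_measurable (Omega :: (int ^ 'd \<Rightarrow> int) measure)" and a: "a = 1 \<or> a = -1"
  shows "(\<lambda>\<eta>. f (\<eta>(x := a))) \<in> borel_measurable (outside_sa x)"
proof (rule outside_measurableI[where g = "\<lambda>\<eta>. f (\<eta>(x := a))"])
  have "(\<lambda>\<eta>. \<eta>(x := a)) \<in> measurable (PiM (UNIV - {x}) (\<lambda>_. count_space {-1, 1})) Omega"
    unfolding Omega_def using a by (intro measurable_fun_upd[where J = "UNIV - {x}"]) auto
  then show "(\<lambda>\<eta>. f (\<eta>(x := a))) \<in> borel_measurable (PiM (UNIV - {x}) (\<lambda>_. count_space {-1, 1}))"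
    by (rule measurable_compose[OF _ f])
  show "f (\<eta>(x := a)) = f ((restrict \<eta> (UNIV - {x}))(x := a))" for \<eta>
    by (rule arg_cong[where f = f]) auto
qed

lemma subalgebra_outside:
  assumes P: "sets P = sets (Omega :: (int ^ 'd \<Rightarrow> int) measure)"
  shows "subalgebra P (outside_sa x)"
proof -
  have "(\<lambda>\<eta>. restrict \<eta> (UNIV - {x})) \<in> measurable (Omega :: (int ^ 'd \<Rightarrow> int) measure) (PiM (UNIV - {x}) (\<lambda>_. count_space {-1, 1}))"
    unfolding Omega_def by (rule measurable_restrict_subset) simp
  then have "sets (outside_sa x) \<subseteq> sets (Omega :: (int ^ 'd \<Rightarrow> int) measure)"
    unfolding outside_sa_def by (subst sets_vimage_algebra2) (auto dest: measurable_space intro: measurable_sets)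
  then show ?thesis
    using P sets_eq_imp_space_eq[OF P] by (simp add: subalgebra_def outside_sa_def)
qed

text \<open>The Markov field property says that \<open>spec\<close> is a version of the conditional
  probability of a plus spin at \<open>x\<close> given the outside. The functions
  \<open>f (\<eta>(x := a))\<close> are outside measurable, so inside integrals against them the
  indicator of the plus spin may be replaced by \<open>spec\<close>.\<close>

lemma MRF_heat_bath_invariant:
  fixes P :: "(int ^ 'd \<Rightarrow> int) measure"
  assumes mrf: "is_MRF \<beta> h J P" and f: "f \<in> borel_measurable P"
    and bd: "\<And>\<eta>. \<eta> \<in> space P \<Longrightarrow> \<bar>f \<eta>\<bar> \<le> M"
  shows "(\<integral>\<eta>. heat_bath (spec \<beta> h J) x f \<eta> \<partial>P) = (\<integral>\<eta>. f \<eta> \<partial>P)"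
proof -
  have sP: "sets P = sets (Omega :: (int ^ 'd \<Rightarrow> int) measure)" and ps: "prob_space P"
    using mrf by (auto simp: is_MRF_def)
  interpret prob_space P by (rule ps)
  have spP: "space P = {\<eta>. \<forall>y. \<eta> y = -1 \<or> \<eta> y = 1}"
    using sets_eq_imp_space_eq[OF sP] by (simp add: space_Omega)
  note sub = subalgebra_outside[OF sP, of x]
  interpret finite_measure_subalgebra P "outside_sa x"
    by unfold_locales (rule sub)
  let ?A = "{\<eta> \<in> space P. \<eta> x = 1}" and ?s = "spec \<beta> h J x"
  let ?F = "\<lambda>a \<eta>. f (\<eta>(x := a))"
  have "(\<lambda>\<eta>. \<eta> x) \<in> measurable P (count_space {-1, 1})"
    using coordinate_measurable[of x UNIV] sP measurable_cong_sets unfolding Omega_def by blast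
  then have "(\<lambda>\<eta>. \<eta> x) -` {1} \<inter> space P \<in> sets P" by (rule measurable_sets) auto
  then have A: "?A \<in> sets P" by (simp add: vimage_def Int_def conj_commute)
  have s_out: "?s \<in> borel_measurable (outside_sa x)" by (rule spec_outside_measurable)
  note s_P = measurable_from_subalg[OF sub s_out]
  have F_out: "?F a \<in> borel_measurable (outside_sa x)" if "a = 1 \<or> a = -1" for a
    using f sP measurable_cong_sets that by (intro update_outside_measurable) blast+
  note F_P = measurable_from_subalg[OF sub F_out]
  have Fb: "\<bar>?F a \<eta>\<bar> \<le> M" if "\<eta> \<in> space P" "a = 1 \<or> a = -1" for a \<eta>
    using that by (intro bd) (auto simp: spP)
  have M: "0 \<le> M" using not_empty bd by (meson abs_ge_zero ex_in_conv order_trans)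
  have ind_int: "integrable P (indicator ?A :: _ \<Rightarrow> real)"
    using A by (intro integrable_const_bound[where B = 1]) (auto intro!: AE_I2 simp: indicator_def)
  have s_int: "integrable P ?s"
  proof (rule integrable_const_bound[where B = 1])
    show "AE \<eta> in P. norm (?s \<eta>) \<le> 1"
    proof (rule AE_I2)
      show "norm (?s \<eta>) \<le> 1" for \<eta> using spec_range[of \<beta> h J x \<eta>] by simp
    qed
  qed (rule s_P)
  have ce: "AE \<eta> in P. real_cond_exp P (outside_sa x) (indicator ?A) \<eta> = ?s \<eta>"
  proof (rule real_cond_exp_charact[OF _ ind_int s_int s_out])
    fix B assume B: "B \<in> sets (outside_sa x :: (int ^ 'd \<Rightarrow> int) measure)"
    then have BP: "B \<in> sets P" using sub by (auto simp: subalgebra_def)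
    have "(\<integral>\<eta>\<in>B. indicator ?A \<eta> \<partial>P) = (\<integral>\<eta>. (indicator (B \<inter> ?A) \<eta> :: real) \<partial>P)"
      unfolding set_lebesgue_integral_def by (simp add: indicator_inter_arith)
    also have "\<dots> = measure P (B \<inter> ?A)" using A BP by simp
    also have "\<dots> = (\<integral>\<eta>\<in>B. ?s \<eta> \<partial>P)" using mrf B unfolding is_MRF_def by blast
    finally show "(\<integral>\<eta>\<in>B. indicator ?A \<eta> \<partial>P) = (\<integral>\<eta>\<in>B. ?s \<eta> \<partial>P)" .
  qed
  have F_int: "integrable P (?F a)" if "a = 1 \<or> a = -1" for a
    using F_P[OF that] Fb that by (intro integrable_const_bound[where B = M]) (auto intro!: AE_I2)
  have IF_int: "integrable P (\<lambda>\<eta>. ?F a \<eta> * indicator ?A \<eta>)" if "a = 1 \<or> a = -1" for a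
    using F_int[OF that] A by (intro integrable_real_mult_indicator)
  have sF_int: "integrable P (\<lambda>\<eta>. ?F a \<eta> * ?s \<eta>)" if "a = 1 \<or> a = -1" for a
  proof (rule integrable_const_bound[where B = M])
    show "AE \<eta> in P. norm (?F a \<eta> * ?s \<eta>) \<le> M"
    proof (rule AE_I2)
      fix \<eta> assume "\<eta> \<in> space P"
      then have "\<bar>?F a \<eta>\<bar> * \<bar>?s \<eta>\<bar> \<le> M * 1"
        using Fb that spec_range[of \<beta> h J x \<eta>] M by (intro mult_mono) auto
      then show "norm (?F a \<eta> * ?s \<eta>) \<le> M" by (simp add: abs_mult)
    qed
    show "(\<lambda>\<eta>. ?F a \<eta> * ?s \<eta>) \<in> borel_measurable P"
      using F_P[OF that] s_P by measurable
  qed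
  have key: "(\<integral>\<eta>. ?F a \<eta> * indicator ?A \<eta> \<partial>P) = (\<integral>\<eta>. ?F a \<eta> * ?s \<eta> \<partial>P)" if "a = 1 \<or> a = -1" for a
  proof -
    have "(\<integral>\<eta>. ?F a \<eta> * indicator ?A \<eta> \<partial>P) = (\<integral>\<eta>. ?F a \<eta> * real_cond_exp P (outside_sa x) (indicator ?A) \<eta> \<partial>P)"
      using real_cond_exp_intg(2)[OF IF_int[OF that] F_out[OF that]] A by simp
    also have "\<dots> = (\<integral>\<eta>. ?F a \<eta> * ?s \<eta> \<partial>P)"
    proof (rule integral_cong_AE)
      show "AE \<eta> in P. ?F a \<eta> * real_cond_exp P (outside_sa x) (indicator ?A) \<eta> = ?F a \<eta> * ?s \<eta>"
        using ce by eventually_elim simp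
      show "(\<lambda>\<eta>. ?F a \<eta> * real_cond_exp P (outside_sa x) (indicator ?A) \<eta>) \<in> borel_measurable P"
        using F_P[OF that] by measurable
      show "(\<lambda>\<eta>. ?F a \<eta> * ?s \<eta>) \<in> borel_measurable P"
        using F_P[OF that] s_P by measurable
    qed
    finally show ?thesis .
  qed
  \<comment> \<open>Each configuration coincides with its update to the spin it already has, so
    \<open>f\<close> splits according to the sign at \<open>x\<close>.\<close>
  have "(\<integral>\<eta>. f \<eta> \<partial>P) = (\<integral>\<eta>. ?F 1 \<eta> * indicator ?A \<eta> + (?F (-1) \<eta> - ?F (-1) \<eta> * indicator ?A \<eta>) \<partial>P)"
  proof (rule Bochner_Integration.integral_cong)
    fix \<eta> assume \<eta>: "\<eta> \<in> space P"
    then have "\<eta> x = -1 \<or> \<eta> x = 1" by (auto simp: spP)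
    then have "\<eta> = \<eta>(x := -1) \<and> \<eta> x = -1 \<or> \<eta> = \<eta>(x := 1) \<and> \<eta> x = 1" by (metis fun_upd_triv)
    then show "f \<eta> = ?F 1 \<eta> * indicator ?A \<eta> + (?F (-1) \<eta> - ?F (-1) \<eta> * indicator ?A \<eta>)"
      using \<eta> by (auto simp: indicator_def)
  qed simp
  also have "\<dots> = (\<integral>\<eta>. ?F 1 \<eta> * ?s \<eta> \<partial>P) + ((\<integral>\<eta>. ?F (-1) \<eta> \<partial>P) - (\<integral>\<eta>. ?F (-1) \<eta> * ?s \<eta> \<partial>P))"
    using F_int[of "-1"] IF_int[of "-1"] IF_int[of 1] by (simp add: key)
  also have "\<dots> = (\<integral>\<eta>. ?F 1 \<eta> * ?s \<eta> + (?F (-1) \<eta> - ?F (-1) \<eta> * ?s \<eta>) \<partial>P)"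
    using F_int[of "-1"] sF_int[of "-1"] sF_int[of 1] by simp
  also have "\<dots> = (\<integral>\<eta>. heat_bath (spec \<beta> h J) x f \<eta> \<partial>P)"
    by (intro Bochner_Integration.integral_cong) (auto simp: heat_bath_def algebra_simps)
  finally show ?thesis ..
qed

text \<open>At most \<open>2 * d\<close> neighbours each have influence \<open>p\<close> and weight
  at most twice that of \<open>x\<close>, which gives the contraction constant.\<close>

lemma dobrushin_MRF:
  fixes P :: "(int ^ 'd \<Rightarrow> int) measure" and \<beta> h J p :: real
  defines "p \<equiv> exp (- 2 * \<beta> * h) * (exp (4 * \<beta> * CARD('d)) - exp (- 4 * \<beta> * CARD('d)))"
  assumes \<beta>: "0 < \<beta>" and J: "J \<in> {-1, 1}" and mrf: "is_MRF \<beta> h J P" and small: "4 * real CARD('d) * p < 1"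
  shows "dobrushin P (spec \<beta> h J) (\<lambda>x y. if nbr x y then p else 0) (\<lambda>x. 2 ^ l1 x) (4 * real CARD('d) * p)"
proof -
  have sP: "sets P = sets (Omega :: (int ^ 'd \<Rightarrow> int) measure)" and ps: "prob_space P"
    using mrf by (auto simp: is_MRF_def)
  note spP = sets_eq_imp_space_eq[OF sP]
  have p: "0 < p" using \<beta> by (simp add: p_def)
  interpret prob_space P by (rule ps)
  show ?thesis
  proof unfold_locales
    show "sets P = sets (PiM UNIV (\<lambda>_. count_space {-1, 1}))" using sP by (simp add: Omega_def)
    then show "spec \<beta> h J x \<in> borel_measurable P" for x
      using spec_measurable_PiM[of x UNIV] measurable_cong_sets by blast
    show "0 \<le> spec \<beta> h J x \<eta> \<and> spec \<beta> h J x \<eta> \<le> 1" for x \<eta> by (rule spec_range)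
    show "\<bar>spec \<beta> h J x (\<eta>(y := - \<eta> y)) - spec \<beta> h J x \<eta>\<bar> \<le> (if nbr x y then p else 0)" if "\<eta> \<in> space P" for x y \<eta>
    proof (cases "nbr x y")
      case True
      have "\<eta>(y := - \<eta> y) \<in> space Omega" "\<eta> \<in> space Omega" using that by (auto simp: spP space_Omega)
      then show ?thesis using True spec_diff_le[OF \<beta> J] by (simp add: p_def)
    next
      case False
      then have "spec \<beta> h J x (\<eta>(y := - \<eta> y)) = spec \<beta> h J x \<eta>" by (intro spec_cong) auto
      then show ?thesis using False by simp
    qed
    show "spec \<beta> h J x \<eta> = spec \<beta> h J x \<zeta>"
      if "\<And>y. (if nbr x y then p else 0) \<noteq> 0 \<Longrightarrow> \<eta> y = \<zeta> y" for x \<eta> \<zeta>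
      using that p by (intro spec_cong) auto
    show "(if nbr x x then p else 0) = 0" for x by (simp add: not_nbr_self)
    show "finite {y. (if nbr x y then p else 0) \<noteq> 0}" for x
      by (rule finite_subset[OF _ nbr_set_finite[of x]]) auto
    show "(\<Sum>y | (if nbr x y then p else 0) \<noteq> 0. (if nbr x y then p else 0) * 2 ^ l1 y) \<le> 4 * real CARD('d) * p * 2 ^ l1 x" for x :: "int ^ 'd"
    proof -
      have "(\<Sum>y | (if nbr x y then p else 0) \<noteq> 0. (if nbr x y then p else 0) * 2 ^ l1 y) = (\<Sum>y | nbr x y. p * 2 ^ l1 y)"
        using p by (intro sum.cong) auto
      also have "\<dots> \<le> card {y. nbr x y} * (p * 2 ^ Suc (l1 x))"
        using p by (intro sum_bounded_above mult_left_mono power_increasing l1_nbr) auto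
      also have "\<dots> \<le> real (2 * CARD('d)) * (p * 2 ^ Suc (l1 x))"
        using p nbr_set_card[of x] by (intro mult_right_mono of_nat_mono) auto
      finally show ?thesis by simp
    qed
    show "finite {y :: int ^ 'd. 2 ^ l1 y \<le> R}" for R :: real
    proof -
      obtain n where n: "R < 2 ^ n" using real_arch_pow[of 2 R] by auto
      have "l1 y \<le> n" if "2 ^ l1 y \<le> R" for y :: "int ^ 'd"
      proof -
        have "(2::real) ^ l1 y < 2 ^ n" using that n by linarith
        then show ?thesis by simp
      qed
      then show ?thesis by (intro finite_subset[OF _ finite_l1_ball[of n]]) auto
    qed
  qed (use small MRF_heat_bath_invariant[OF mrf] in auto)
qed

section \<open>Percolation and truncation\<close>

lemma coordinate_perc_measurable: "(\<lambda>\<omega>. \<omega> y) \<in> measurable (perc p) (count_space UNIV)"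
  using measurable_component_singleton[of y UNIV "\<lambda>_. measure_pmf (bernoulli_pmf p)"]
  unfolding perc_def by (simp add: measurable_cong_sets[OF refl sets_measure_pmf_count_space])

text \<open>Monotonicity of \<open>measure\<close> requires the larger event to be measurable.
  Connection is a countable union over path lengths, and a finite set of sites can be chosen in
  countably many ways.\<close>

lemma cluster_event_measurable:
  "{\<omega> \<in> space (perc p). \<exists>F. F \<subseteq> cluster \<omega> \<and> finite F \<and> card F = n} \<in> sets (perc p :: (int ^ 'd \<Rightarrow> bool) measure)"
proof -
  let ?P = "perc p :: (int ^ 'd \<Rightarrow> bool) measure" and ?R = "\<lambda>\<omega> a b. \<omega> a \<and> \<omega> b \<and> nbr a b"
  note [measurable] = coordinate_perc_measurable
  have path: "Measurable.pred ?P (\<lambda>\<omega>. (?R \<omega> ^^ k) 0 y)" for k y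
  proof (induction k arbitrary: y)
    case 0
    show ?case by simp
  next
    case (Suc k)
    note Suc[measurable]
    have "Measurable.pred ?P (\<lambda>\<omega>. \<exists>z. (?R \<omega> ^^ k) 0 z \<and> \<omega> z \<and> \<omega> y \<and> nbr z y)" by measurable
    then show ?case by (simp add: relcompp_apply)
  qed
  have [measurable]: "Measurable.pred ?P (\<lambda>\<omega>. y \<in> cluster \<omega>)" for y
  proof -
    note path[measurable]
    have "Measurable.pred ?P (\<lambda>\<omega>. \<omega> 0 \<and> (\<exists>k. (?R \<omega> ^^ k) 0 y))" by measurable
    then show ?thesis by (simp add: cluster_def rtranclp_power)
  qed
  have "{\<omega> \<in> space ?P. \<exists>F. F \<subseteq> cluster \<omega> \<and> finite F \<and> card F = n}
      = (\<Union>F\<in>{F. finite F \<and> card F = n}. {\<omega> \<in> space ?P. \<forall>y\<in>F. y \<in> cluster \<omega>})"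
    by auto
  also have "\<dots> \<in> sets ?P"
  proof (rule sets.countable_UN'')
    show "countable {F :: (int ^ 'd) set. finite F \<and> card F = n}"
      by (rule countable_subset[OF _ countable_Collect_finite]) auto
    show "{\<omega> \<in> space ?P. \<forall>y\<in>F. y \<in> cluster \<omega>} \<in> sets ?P" if "F \<in> {F. finite F \<and> card F = n}" for F
      using that by (intro sets.sets_Collect_finite_All) (auto simp flip: pred_def)
  qed
  finally show ?thesis .
qed

text \<open>Here \<open>undefined\<close> just names one coordinate direction.\<close>

definition axis_site :: "nat \<Rightarrow> int ^ 'd" where
  "axis_site i = (\<chi> j. if j = undefined then int i else 0)"

lemma nbr_axis_site: "nbr (axis_site i :: int ^ 'd) (axis_site (Suc i))"
proof -
  have "\<bar>(axis_site i :: int ^ 'd) $ j - axis_site (Suc i) $ j\<bar> = (if j = undefined then 1 else 0)"  for j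
    by (simp add: axis_site_def)
  then show ?thesis unfolding nbr_def by simp
qed

lemma inj_axis_site: "inj (axis_site :: nat \<Rightarrow> int ^ 'd)"
proof (rule injI)
  fix i j assume "axis_site i = (axis_site j :: int ^ 'd)"
  then have "(axis_site i :: int ^ 'd) $ undefined = (axis_site j :: int ^ 'd) $ undefined" by (rule arg_cong)
  then show "i = j" by (simp add: axis_site_def)
qed

lemma cluster_tail_ge_power:
  assumes p: "0 \<le> p" "p \<le> 1"
  shows "p ^ n \<le> cluster_tail p n TYPE('d::finite)"
proof -
  let ?P = "perc p :: (int ^ 'd \<Rightarrow> bool) measure" and ?M = "\<lambda>_ :: int ^ 'd. measure_pmf (bernoulli_pmf p)"
  interpret product_prob_space ?M UNIV
    by unfold_locales
  \<comment> \<open>The indices start at 0, so these are \<open>n\<close> sites including the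
    origin, which must itself be open.\<close>
  let ?J = "axis_site ` {..<n} :: (int ^ 'd) set"
  let ?E = "prod_emb UNIV ?M ?J (Pi\<^sub>E ?J (\<lambda>_. {True}))"
  have "emeasure ?P ?E = (\<Prod>y\<in>?J. emeasure (measure_pmf (bernoulli_pmf p)) {True})"
    unfolding perc_def by (rule emeasure_PiM_emb) auto
  also have "\<dots> = ennreal (p ^ n)"
    using p by (simp add: emeasure_pmf_single card_image inj_on_subset[OF inj_axis_site] ennreal_power)
  finally have E: "measure ?P ?E = p ^ n" using p by (simp add: measure_def)
  have line: "axis_site i \<in> cluster \<omega>" if "i < n" "\<forall>i<n. \<omega> (axis_site i)" for \<omega> :: "int ^ 'd \<Rightarrow> bool" and i
  proof -
    have 0: "axis_site 0 = (0 :: int ^ 'd)" by (simp add: axis_site_def vec_eq_iff)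
    show ?thesis using that(1)
    proof (induction i)
      case 0
      then show ?case using that(2) by (auto simp: cluster_def 0 \<open>axis_site 0 = 0\<close>[symmetric])
    next
      case (Suc i)
      then have "axis_site i \<in> cluster \<omega>" "\<omega> (axis_site i)" "\<omega> (axis_site (Suc i))" using that(2) by auto
      then show ?case unfolding cluster_def using nbr_axis_site[of i]
        by (auto intro: rtranclp.rtrancl_into_rtrancl)
    qed
  qed
  have "measure ?P ?E \<le> measure ?P {\<omega> \<in> space ?P. \<exists>F. F \<subseteq> cluster \<omega> \<and> finite F \<and> card F = n}"
  proof (rule finite_measure.finite_measure_mono[OF _ _ cluster_event_measurable])
    show "finite_measure ?P" unfolding perc_def by (rule P.finite_measure_axioms)
    show "?E \<subseteq> {\<omega> \<in> space ?P. \<exists>F. F \<subseteq> cluster \<omega> \<and> finite F \<and> card F = n}"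
    proof safe
      fix \<omega> assume \<omega>: "\<omega> \<in> ?E"
      then show "\<omega> \<in> space ?P" by (simp add: perc_def prod_emb_def space_PiM)
      have r: "restrict \<omega> ?J \<in> Pi\<^sub>E ?J (\<lambda>_. {True})" using \<omega> by (simp add: prod_emb_def)
      have open_line: "\<forall>i<n. \<omega> (axis_site i)"
      proof (intro allI impI)
        fix i assume "i < n"
        then have i: "axis_site i \<in> ?J" by simp
        show "\<omega> (axis_site i)" using PiE_mem[OF r i] unfolding restrict_apply'[OF i] by simp
      qed
      show "\<exists>F. F \<subseteq> cluster \<omega> \<and> finite F \<and> card F = n"
        using line open_line by (intro exI[of _ ?J]) (auto simp: card_image inj_on_subset[OF inj_axis_site])
    qed
  qed
  then show ?thesis unfolding E cluster_tail_def .
qed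

text \<open>The straight line of \<open>n\<close> sites is open with probability \<open>p ^ n\<close>, so the terms of the series can only
  tend to zero if \<open>(2 d - 1) exp (4 \<beta> d) sqrt p < 1\<close>.\<close>

lemma percolation_smallness:
  fixes p \<beta> :: real
  assumes d: "2 \<le> CARD('d::finite)" and \<beta>: "0 < \<beta>" and p: "0 \<le> p" "p \<le> 1"
    and sum: "summable (\<lambda>n. real n * (2 * real CARD('d) - 1) ^ n * exp (4 * \<beta> * CARD('d) * n)
           * sqrt (cluster_tail p n TYPE('d)))"
  shows "4 * real CARD('d) * p < 1"
proof -
  let ?d = "real CARD('d)"
  have d2: "2 \<le> ?d" using d by simp
  define q where "q = (2 * ?d - 1) * exp (4 * \<beta> * ?d) * sqrt p"
  have q0: "0 \<le> q" using d2 p by (simp add: q_def)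
  have bound: "real n * q ^ n \<le> real n * (2 * ?d - 1) ^ n * exp (4 * \<beta> * ?d * n) * sqrt (cluster_tail p n TYPE('d))" for n
  proof -
    have "q ^ n = (2 * ?d - 1) ^ n * exp (4 * \<beta> * ?d * n) * sqrt (p ^ n)"
      by (simp add: q_def power_mult_distrib exp_of_nat2_mult real_sqrt_power)
    moreover have "sqrt (p ^ n) \<le> sqrt (cluster_tail p n TYPE('d))"
      using cluster_tail_ge_power[OF p] by simp
    ultimately have "q ^ n \<le> (2 * ?d - 1) ^ n * exp (4 * \<beta> * ?d * n) * sqrt (cluster_tail p n TYPE('d))"
      using d2 by (simp add: mult_left_mono)
    then show ?thesis by (simp add: mult_left_mono mult.assoc)
  qed
  have "q < 1"
  proof (rule ccontr)
    assume "\<not> q < 1"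
    then have q: "1 \<le> q ^ n" for n by (simp add: one_le_power)
    have "1 \<le> real n * (2 * ?d - 1) ^ n * exp (4 * \<beta> * ?d * n) * sqrt (cluster_tail p n TYPE('d))" if "1 \<le> n" for n
    proof -
      have "1 * 1 \<le> real n * q ^ n" using that q[of n] by (intro mult_mono) auto
      then show ?thesis using bound[of n] by simp
    qed
    then have "1 \<le> (0 :: real)"
      by (intro LIMSEQ_le_const[OF summable_LIMSEQ_zero[OF sum]]) blast
    then show False by simp
  qed
  have "(2 * ?d - 1) * 1 * sqrt p \<le> q"
    unfolding q_def using d2 \<beta> p by (intro mult_right_mono mult_left_mono) auto
  then have "(2 * ?d - 1) * sqrt p < 1" using \<open>q < 1\<close> by simp
  then have "((2 * ?d - 1) * sqrt p)\<^sup>2 < 1"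
    using d2 p by (simp add: abs_square_less_1 abs_mult)
  then have "(2 * ?d - 1)\<^sup>2 * p < 1" using p by (simp add: power_mult_distrib)
  \<comment> \<open>This is where dimension at least 2 enters; for \<open>d = 2\<close> it reads 8
    against 9.\<close>
  moreover have "4 * ?d \<le> (2 * ?d - 1)\<^sup>2"
  proof -
    have "2 * ?d \<le> ?d * ?d" using d2 by (intro mult_right_mono) auto
    moreover have "(2 * ?d - 1)\<^sup>2 = 4 * (?d * ?d) - 4 * ?d + 1"
      by (simp add: power2_eq_square algebra_simps)
    ultimately show ?thesis by linarith
  qed
  then have "4 * ?d * p \<le> (2 * ?d - 1)\<^sup>2 * p" using p by (intro mult_right_mono)
  ultimately show ?thesis by linarith
qed

text \<open>A non-integrable function has Bochner integral 0, so the inequality persists in that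
  case.\<close>

lemma ennreal_integral_le_nn_integral:
  fixes g :: "'a \<Rightarrow> real"
  assumes "\<And>x. 0 \<le> g x"
  shows "ennreal (\<integral>x. g x \<partial>M) \<le> (\<integral>\<^sup>+x. ennreal (g x) \<partial>M)"
proof (cases "integrable M g")
  case True
  then show ?thesis using assms by (simp add: nn_integral_eq_integral)
qed (simp add: not_integrable_integral_eq)

section \<open>Truncation of square-integrable functions\<close>

definition clip :: "nat \<Rightarrow> real \<Rightarrow> real" where "clip n a = max (- real n) (min (real n) a)"

text \<open>The Lipschitz bound makes every gradient shrink under truncation, so the Dirichlet form
  does not increase; the second bound provides dominating functions.\<close>

lemma clip_bounds: "\<bar>clip n a\<bar> \<le> real n" "\<bar>clip n a\<bar> \<le> \<bar>a\<bar>" "\<bar>clip n a - clip n b\<bar> \<le> \<bar>a - b\<bar>"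
  by (auto simp: clip_def max_def min_def abs_if)

lemma clip_tendsto: "(\<lambda>n. clip n a) \<longlonglongrightarrow> a"
proof (rule tendsto_eventually)
  obtain N :: nat where "\<bar>a\<bar> \<le> real N" using real_arch_simple by blast
  then have "clip n a = a" if "N \<le> n" for n
    using that by (auto simp: clip_def max_def min_def abs_le_iff)
  then show "\<forall>\<^sub>F n in sequentially. clip n a = a" by (auto simp: eventually_sequentially)
qed

lemma (in prob_space) variance_clip_tendsto:
  assumes f: "f \<in> borel_measurable M" and f2: "integrable M (\<lambda>x. (f x)\<^sup>2)"
  shows "(\<lambda>n. variance (\<lambda>x. clip n (f x))) \<longlonglongrightarrow> variance f"
proof -
  note [measurable] = f
  have f1: "integrable M f" by (rule square_integrable_imp_integrable[OF f f2])
  have cm: "(\<lambda>x. clip n (f x)) \<in> borel_measurable M" for n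
    unfolding clip_def by measurable
  note [measurable] = cm
  have sq: "(clip n a)\<^sup>2 \<le> a\<^sup>2" for n a using clip_bounds(2)[of n a] by (simp add: abs_le_square_iff)
  have i: "integrable M (\<lambda>x. clip n (f x))" "integrable M (\<lambda>x. (clip n (f x))\<^sup>2)" for n
    by (rule Bochner_Integration.integrable_bound[OF f1], use clip_bounds in auto)
      (rule Bochner_Integration.integrable_bound[OF f2], use sq in auto)
  have "(\<lambda>n. \<integral>x. clip n (f x) \<partial>M) \<longlonglongrightarrow> (\<integral>x. f x \<partial>M)"
    by (rule integral_dominated_convergence[where w = "\<lambda>x. \<bar>f x\<bar>"])
      (use f1 clip_bounds clip_tendsto in auto)
  moreover have "(\<lambda>n. \<integral>x. (clip n (f x))\<^sup>2 \<partial>M) \<longlonglongrightarrow> (\<integral>x. (f x)\<^sup>2 \<partial>M)"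
    by (rule integral_dominated_convergence[where w = "\<lambda>x. (f x)\<^sup>2"])
      (use f2 sq in \<open>auto intro!: tendsto_power clip_tendsto\<close>)
  ultimately have "(\<lambda>n. (\<integral>x. (clip n (f x))\<^sup>2 \<partial>M) - (\<integral>x. clip n (f x) \<partial>M)\<^sup>2) \<longlonglongrightarrow> (\<integral>x. (f x)\<^sup>2 \<partial>M) - (\<integral>x. f x \<partial>M)\<^sup>2"
    by (intro tendsto_diff tendsto_power)
  then show ?thesis using i f1 f2 by (simp add: variance_eq)
qed

theorem theorem2:
  fixes \<beta> h J :: real and P :: "(int ^ 'd \<Rightarrow> int) measure"
  assumes "CARD('d) \<ge> 2"
    and "\<beta> > 0" and "h \<ge> 0" and "J \<in> {-1, 1}"
    and "is_MRF \<beta> h J P"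
    and "exp (- 2 * \<beta> * h) * (exp (4 * \<beta> * CARD('d)) - exp (- 4 * \<beta> * CARD('d))) < 1"
    and "summable (\<lambda>n::nat. real n * (2 * real CARD('d) - 1) ^ n * exp (4 * \<beta> * CARD('d) * n)
           * sqrt (cluster_tail (exp (- 2 * \<beta> * h) * (exp (4 * \<beta> * CARD('d)) - exp (- 4 * \<beta> * CARD('d)))) n TYPE('d)))"
  shows "\<exists>C>0. \<forall>f. f \<in> borel_measurable P \<longrightarrow> integrable P (\<lambda>\<eta>. (f \<eta>)\<^sup>2) \<longrightarrow>
           ennreal (\<integral>\<eta>. (f \<eta> - (\<integral>\<xi>. f \<xi> \<partial>P))\<^sup>2 \<partial>P) \<le> ennreal C * dirichlet P f"
proof -
  define p where "p = exp (- 2 * \<beta> * h) * (exp (4 * \<beta> * CARD('d)) - exp (- 4 * \<beta> * CARD('d)))"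
  have "0 \<le> p" "p \<le> 1" using assms(2,6) by (auto simp: p_def)
  then have small: "4 * real CARD('d) * p < 1"
    using assms(1,2,7) by (intro percolation_smallness) (auto simp: p_def)
  interpret dobrushin P "spec \<beta> h J" "\<lambda>x y. if nbr x y then p else 0" "\<lambda>x. 2 ^ l1 x" "4 * real CARD('d) * p"
    using dobrushin_MRF[OF assms(2,4,5), folded p_def] small by blast
  let ?C = "2 / (1 - 4 * real CARD('d) * p)"
  have C: "0 < ?C" using small by simp
  have "ennreal (variance f) \<le> ennreal ?C * dirichlet P f"
    if f: "f \<in> borel_measurable P" and f2: "integrable P (\<lambda>\<eta>. (f \<eta>)\<^sup>2)" for f
  proof (rule LIMSEQ_le_const2)
    show "(\<lambda>n. ennreal (variance (\<lambda>\<eta>. clip n (f \<eta>)))) \<longlonglongrightarrow> ennreal (variance f)"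
      by (intro tendsto_ennrealI variance_clip_tendsto f f2)
    \<comment> \<open>The set \<open>L\<close> depends on \<open>e\<close>, so its sum is first
      absorbed into \<open>dirichlet P f\<close>; then \<open>e\<close> is released, and the limit
      in \<open>n\<close> comes last.\<close>
    have "ennreal (variance (\<lambda>\<eta>. clip n (f \<eta>))) \<le> ennreal ?C * dirichlet P f" for n
    proof (rule ennreal_le_epsilon)
      fix e :: real assume e: "0 < e"
      let ?g = "\<lambda>\<eta>. clip n (f \<eta>)"
      let ?D = "\<lambda>f x. \<lambda>\<eta>. (f (flip \<eta> x) - f \<eta>)\<^sup>2 :: real"
      have g: "bdd (real n) ?g"
        using f clip_bounds unfolding bdd_def clip_def by (auto intro!: borel_measurable_max borel_measurable_min)
      obtain L where L: "finite L" and V: "variance ?g \<le> ?C * (\<Sum>x\<in>L. \<integral>\<eta>. ?D ?g x \<eta> \<partial>P) + e"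
        using poincare_bounded[OF g e] unfolding flip_def by blast
      have S0: "0 \<le> (\<Sum>x\<in>L. \<integral>\<eta>. ?D ?g x \<eta> \<partial>P)" by (intro sum_nonneg integral_nonneg_AE) auto
      have "ennreal (variance ?g) \<le> ennreal ?C * ennreal (\<Sum>x\<in>L. \<integral>\<eta>. ?D ?g x \<eta> \<partial>P) + ennreal e"
        using V C e S0 by (simp add: ennreal_mult[symmetric] ennreal_plus[symmetric] ennreal_leI del: ennreal_plus)
      also have "ennreal (\<Sum>x\<in>L. \<integral>\<eta>. ?D ?g x \<eta> \<partial>P) = (\<Sum>x\<in>L. ennreal (\<integral>\<eta>. ?D ?g x \<eta> \<partial>P))"
        by (intro sum_ennreal[symmetric] integral_nonneg_AE) auto
      also have "\<dots> \<le> (\<Sum>x\<in>L. \<integral>\<^sup>+\<eta>. ennreal (?D f x \<eta>) \<partial>P)"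
      proof (rule sum_mono)
        fix x
        have "ennreal (\<integral>\<eta>. ?D ?g x \<eta> \<partial>P) \<le> (\<integral>\<^sup>+\<eta>. ennreal (?D ?g x \<eta>) \<partial>P)"
          by (rule ennreal_integral_le_nn_integral) simp
        also have "\<dots> \<le> (\<integral>\<^sup>+\<eta>. ennreal (?D f x \<eta>) \<partial>P)"
          using clip_bounds(3) by (intro nn_integral_mono ennreal_leI) (simp add: abs_le_square_iff[symmetric])
        finally show "ennreal (\<integral>\<eta>. ?D ?g x \<eta> \<partial>P) \<le> (\<integral>\<^sup>+\<eta>. ennreal (?D f x \<eta>) \<partial>P)" .
      qed
      also have "\<dots> \<le> dirichlet P f"
        unfolding dirichlet_def using L by (intro SUP_upper) simp
      finally show "ennreal (variance ?g) \<le> ennreal ?C * dirichlet P f + ennreal e"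
        by (simp add: mult_left_mono add_right_mono)
    qed
    then show "\<exists>N. \<forall>n\<ge>N. ennreal (variance (\<lambda>\<eta>. clip n (f \<eta>))) \<le> ennreal ?C * dirichlet P f" by blast
  qed
  then show ?thesis using C by blast
qed

end
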